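(* Let $G$ be a connected $(S_{1,2,2},N)$-free graph. Then $rvc(G)\leq diam(G)+11$.
   Context: All graphs are simple, finite, undirected. For a graph $G$ with a vertex-coloring (adjacent vertices may share colors), a path is vertex-rainbow if its internal vertices have pairwise distinct colors; $G$ is rainbow vertex-connected if every two distinct vertices are joined by a vertex-rainbow path. For a connected graph $G$, $rvc(G)$ is the minimum number of colors in a vertex-coloring making $G$ rainbow vertex-connected (complete graphs have $rvc=0$). $diam(G)$ is the diameter. $G$ is $(S_{1,2,2},N)$-free if it has no induced subgraph isomorphic to $S_{1,2,2}$ or $N$, where $S_{1,2,2}$ is obtained by identifying one endvertex from each of three vertex-disjoint paths of lengths $1,2,2$, and $N$ (the net) is obtained by attaching a pendant edge to each vertex of a triangle. *)

theory Defs
  imports "Graph_Theory.Graph_Theory"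
begin

text \<open>
  A simple, finite, undirected graph is a \<^locale>\<open>pair_graph\<close>: a finite, loopfree, symmetric
  digraph whose arcs are pairs of vertices, the edge \<open>uv\<close> being the two arcs \<open>(u, v)\<close>, \<open>(v, u)\<close>.
\<close>

text \<open>\<open>inner_verts\<close> drops both endpoints of a path.\<close>

definition vertex_rainbow_path ::
    "('a, 'b) pre_digraph \<Rightarrow> ('a \<Rightarrow> 'c) \<Rightarrow> 'a \<Rightarrow> 'b awalk \<Rightarrow> 'a \<Rightarrow> bool" where
  "vertex_rainbow_path G c u p v \<longleftrightarrow>
     pre_digraph.apath G u p v \<and> inj_on c (set (pre_digraph.inner_verts G p))"

definition rainbow_vertex_connected :: "('a, 'b) pre_digraph \<Rightarrow> ('a \<Rightarrow> 'c) \<Rightarrow> bool" where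
  "rainbow_vertex_connected G c \<longleftrightarrow>
     (\<forall>u \<in> verts G. \<forall>v \<in> verts G. u \<noteq> v \<longrightarrow> (\<exists>p. vertex_rainbow_path G c u p v))"

text \<open>
  The convention that complete graphs have value 0 has to be imposed: a colouring of a nonempty
  vertex set uses at least one colour. The minimum is attained only for connected graphs.
\<close>

definition rvc :: "('a, 'b) pre_digraph \<Rightarrow> nat" where
  "rvc G = (if complete_digraph (card (verts G)) G then 0
     else LEAST k. \<exists>c :: 'a \<Rightarrow> nat. rainbow_vertex_connected G c \<and> card (c ` verts G) = k)"

text \<open>The distance of two vertices is the cost of a shortest walk under unit arc weights.\<close>

definition diam :: "('a, 'b) pre_digraph \<Rightarrow> ereal" where
  "diam G = (SUP u \<in> verts G. SUP v \<in> verts G. wf_digraph.\<mu> G (\<lambda>_. 1) u v)"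

definition induced_free :: "('c, 'd) pre_digraph \<Rightarrow> ('a, 'b) pre_digraph \<Rightarrow> bool" where
  "induced_free F G \<longleftrightarrow> \<not> (\<exists>H. induced_subgraph H G \<and> digraph_iso H F)"

text \<open>Paths \<open>0 1\<close>, \<open>0 2 3\<close> and \<open>0 4 5\<close> glued at \<open>0\<close>; \<open>symcl\<close> (superscript s) adds the reverse arcs.\<close>

definition S122 :: "nat pair_pre_digraph" where
  "S122 = \<lparr> pverts = {0, 1, 2, 3, 4, 5},
            parcs = {(0, 1), (0, 2), (2, 3), (0, 4), (4, 5)}\<^sup>s \<rparr>"

text \<open>Triangle \<open>0 1 2\<close> with pendant edges \<open>0 3\<close>, \<open>1 4\<close>, \<open>2 5\<close>.\<close>

definition net :: "nat pair_pre_digraph" where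
  "net = \<lparr> pverts = {0, 1, 2, 3, 4, 5},
           parcs = {(0, 1), (1, 2), (0, 2), (0, 3), (1, 4), (2, 5)}\<^sup>s \<rparr>"

lemma pair_graph_S122: "pair_graph S122"
  by unfold_locales (auto simp: S122_def symcl_def symmetric_def sym_def)

lemma pair_graph_net: "pair_graph net"
  by unfold_locales (auto simp: net_def symcl_def symmetric_def sym_def)

end

theory Submission
  imports Defs
begin

text \<open>
  Let \<open>P = v\<^sub>0 \<dots> v\<^sub>d\<close> be a shortest path between two vertices at distance \<open>d = diam G \<ge> 3\<close>, and call the
  distance of a vertex to \<open>P\<close> its level. As \<open>P\<close> is geodesic, freeness of \<open>S\<^sub>1\<^sub>,\<^sub>2\<^sub>,\<^sub>2\<close> and the net forces a
  vertex of level 1 with a neighbour of level 2 to be adjacent to \<open>v\<^sub>0\<close> or \<open>v\<^sub>d\<close>; so everything of level at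
  least 2 hangs off the left or the right end of \<open>P\<close>. Moreover two vertices of the same level on the
  same side are equal, adjacent or have a common parent, so colouring a side by level makes it rainbow
  connected.

  If all levels are at most 6, give the vertices of \<open>P\<close> distinct colours and add one colour per side
  for each of the levels 1 to 5: this uses \<open>d + 11\<close> colours.

  If some vertex has level at least 7, its geodesics to \<open>v\<^sub>0\<close> and \<open>v\<^sub>d\<close> are too short to pass through the other
  end of \<open>P\<close>, so the two sides meet. A shortest connection between them outside the neighbourhood of \<open>P\<close> closes \<open>P\<close>
  to a cycle of length at most \<open>2 d + 3\<close>. The vertices of level at least 2 have two neighbours on this
  cycle and the others have one on \<open>P\<close>, so that colouring the cycle periodically with \<open>d + 3\<close> colours
  suffices.
\<close>

section \<open>Walks as relation powers, and congruent indices\<close>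

lemma relpow_symI:
  assumes "sym r" "(x, y) \<in> r ^^ n" shows "(y, x) \<in> r ^^ n"
  using assms(2)
proof (induction n arbitrary: y)
  case (Suc n)
  then obtain z where "(x, z) \<in> r ^^ n" "(z, y) \<in> r" by auto
  then show ?case using Suc.IH \<open>sym r\<close> by (blast intro: relpow_Suc_I2 dest: symD)
qed simp

lemma relpow_addI: "(x, y) \<in> r ^^ m \<Longrightarrow> (y, z) \<in> r ^^ n \<Longrightarrow> (x, z) \<in> r ^^ (m + n)"
  by (auto simp: relpow_add)

lemma relpow_mono:
  fixes r s :: "'a rel"
  shows "r \<subseteq> s \<Longrightarrow> (x, y) \<in> r ^^ n \<Longrightarrow> (x, y) \<in> s ^^ n"
  by (induction n arbitrary: y) auto

lemma relpow_path:
  assumes "\<And>k. i \<le> k \<Longrightarrow> k < j \<Longrightarrow> (f k, f (Suc k)) \<in> r" "i \<le> j"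
  shows "(f i, f j) \<in> r ^^ (j - i)"
proof -
  have "\<exists>g. g 0 = f i \<and> g (j - i) = f j \<and> (\<forall>k<j - i. (g k, g (Suc k)) \<in> r)"
    using assms by (intro exI[of _ "\<lambda>k. f (i + k)"]) auto
  then show ?thesis by (simp only: relpow_fun_conv)
qed

lemma inj_on_insert_less:
  fixes f :: "'a \<Rightarrow> nat"
  assumes "inj_on f C" "\<And>x. x \<in> C \<Longrightarrow> f x < f y"
  shows "inj_on f (insert y C)"
  using assms unfolding inj_on_insert by (metis Diff_iff imageE less_irrefl)

text \<open>The difference is a multiple of \<open>h\<close> that is below \<open>2 * h\<close> and
  different from \<open>h\<close>, hence zero. This yields injectivity of periodic colourings on
  arcs of a cycle.\<close>

lemma mod_eq_close:
  fixes k l h :: nat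
  assumes "k mod h = l mod h" "k \<le> l" "l - k < 2 * h" "l - k \<noteq> h"
  shows "k = l"
proof -
  obtain q where q: "l - k = h * q"
    using assms(1,2) mod_eq_dvd_iff_nat[of k l h] by (auto simp: dvd_def)
  then have "h * q < h * 2" using assms(3) by simp
  then have "q < 2" by simp
  moreover have "q \<noteq> 1" using q assms(4) by auto
  ultimately have "q = 0" by simp
  then show ?thesis using q assms(2) by simp
qed

section \<open>Linked vertices and cycles\<close>

text \<open>In \<open>no_S122\<close> the centre is \<open>c\<close>, the short leg
  \<open>a\<close>, the long legs \<open>b b'\<close> and \<open>e e'\<close>; in
  \<open>no_net\<close> the primed vertices are the pendants. Both patterns consist of edges and
  non-edges only, as these force the six vertices to be distinct (see
  \<open>S122_free_cases\<close>).\<close>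

locale S122_net_free_graph =
  fixes V :: "'a set" and R :: "'a rel"
  assumes R_sub: "R \<subseteq> V \<times> V"
    and R_sym: "sym R"
    and R_irrefl: "(x, x) \<notin> R"
    and no_S122: "\<lbrakk>(c, a) \<in> R; (c, b) \<in> R; (b, b') \<in> R; (c, e) \<in> R; (e, e') \<in> R;
      (a, b) \<notin> R; (a, b') \<notin> R; (a, e) \<notin> R; (a, e') \<notin> R; (c, b') \<notin> R; (c, e') \<notin> R;
      (b, e) \<notin> R; (b, e') \<notin> R; (b', e) \<notin> R; (b', e') \<notin> R\<rbrakk> \<Longrightarrow> False"
    and no_net: "\<lbrakk>(a, b) \<in> R; (b, c) \<in> R; (a, c) \<in> R; (a, a') \<in> R; (b, b') \<in> R; (c, c') \<in> R;
      (a, b') \<notin> R; (a, c') \<notin> R; (b, a') \<notin> R; (b, c') \<notin> R; (c, a') \<notin> R; (c, b') \<notin> R;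
      (a', b') \<notin> R; (a', c') \<notin> R; (b', c') \<notin> R\<rbrakk> \<Longrightarrow> False"
begin

abbreviation adj (infix "\<sim>" 50) where "x \<sim> y \<equiv> (x, y) \<in> R"

lemma adj_commute: "x \<sim> y \<longleftrightarrow> y \<sim> x"
  using R_sym by (meson symD)

lemma adj_V: "x \<sim> y \<Longrightarrow> x \<in> V" "x \<sim> y \<Longrightarrow> y \<in> V"
  using R_sub by auto

lemma relpow_sym: "(x, y) \<in> R ^^ n \<Longrightarrow> (y, x) \<in> R ^^ n"
  using R_sym by (rule relpow_symI)

text \<open>Rainbow paths are replaced by reachability inside a vertex set on which the colouring,
  apart from the two ends, is injective. Walks concatenate freely; a path is extracted only in
  \<open>vertex_rainbow_pathI\<close>.\<close>

definition linked :: "'a set \<Rightarrow> 'a \<Rightarrow> 'a \<Rightarrow> bool" where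
  "linked A x y \<longleftrightarrow> (x, y) \<in> (Restr R A)\<^sup>*"

lemma linked_refl [simp]: "linked A x x"
  by (simp add: linked_def)

lemma linked_trans: "linked A x y \<Longrightarrow> linked A y z \<Longrightarrow> linked A x z"
  unfolding linked_def by (rule rtrancl_trans)

lemma linked_mono: "linked A x y \<Longrightarrow> A \<subseteq> B \<Longrightarrow> linked B x y"
  unfolding linked_def by (erule rtrancl_mono[THEN subsetD, rotated]) auto

lemma linked_sym: "linked A x y \<Longrightarrow> linked A y x"
proof -
  have "sym ((Restr R A)\<^sup>*)" using R_sym by (intro sym_rtrancl symI) (auto dest: symD)
  then show "linked A x y \<Longrightarrow> linked A y x" unfolding linked_def by (rule symD)
qed

lemma linked_edge: "x \<sim> y \<Longrightarrow> x \<in> A \<Longrightarrow> y \<in> A \<Longrightarrow> linked A x y"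
  unfolding linked_def by (rule r_into_rtrancl) auto

lemma linked_edge_trans: "x \<sim> y \<Longrightarrow> linked A y z \<Longrightarrow> x \<in> A \<Longrightarrow> y \<in> A \<Longrightarrow> linked A x z"
  by (rule linked_trans[OF linked_edge])

lemma linked_path:
  assumes "\<And>k. i \<le> k \<Longrightarrow> k < j \<Longrightarrow> f k \<sim> f (Suc k)" "i \<le> j"
  shows "linked (f ` {i..j}) (f i) (f j)"
proof -
  have "(f i, f j) \<in> Restr R (f ` {i..j}) ^^ (j - i)"
    using assms by (intro relpow_path) auto
  then show ?thesis unfolding linked_def by (rule relpow_imp_rtrancl)
qed

definition rainbow :: "('a \<Rightarrow> nat) \<Rightarrow> bool" where
  "rainbow c \<longleftrightarrow> (\<forall>u\<in>V. \<forall>w\<in>V. u \<noteq> w \<longrightarrow> (\<exists>A. linked A u w \<and> inj_on c (A - {u, w})))"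

text \<open>The arc from \<open>i\<close> to \<open>j\<close> serves if \<open>j - i < h\<close>,
  the complementary arc otherwise. On the latter, indices on the same side of the gap differ by less
  than \<open>h\<close>, those on different sides by more than \<open>h\<close> and less than
  \<open>2 * h\<close>, so residues do not clash even if \<open>n < 2 * h\<close>.\<close>

lemma cycle_arc:
  assumes step: "\<And>i. Suc i < n \<Longrightarrow> g i \<sim> g (Suc i)" and close: "g (n - 1) \<sim> g 0"
    and n: "n \<le> 2 * h" and c: "\<And>i. i < n \<Longrightarrow> c (g i) = i mod h"
    and ij: "i \<le> j" "j < n" "j - i \<noteq> h"
  shows "\<exists>A. linked A (g i) (g j) \<and> inj_on c A \<and> g i \<in> A \<and> g j \<in> A"
proof (cases "j - i < h")
  case True
  have "linked (g ` {i..j}) (g i) (g j)" using ij by (intro linked_path step) auto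
  moreover have "inj_on c (g ` {i..j})"
  proof (rule inj_onI)
    have main: "k = l" if "k \<in> {i..j}" "l \<in> {i..j}" "k mod h = l mod h" "k \<le> l" for k l
      using that True by (intro mod_eq_close[of k h l]) auto
    fix y z assume "y \<in> g ` {i..j}" "z \<in> g ` {i..j}" and eq: "c y = c z"
    then obtain k l where k: "y = g k" "z = g l" "k \<in> {i..j}" "l \<in> {i..j}" by auto
    then have "k mod h = l mod h" using eq c ij(2) by auto
    then have "k = l" using main[of k l] main[of l k] k by (cases "k \<le> l") auto
    then show "y = z" using k by simp
  qed
  moreover have "g i \<in> g ` {i..j}" "g j \<in> g ` {i..j}" using ij by auto
  ultimately show ?thesis by blast
next
  case False
  let ?A = "g ` ({..i} \<union> {j..<n})"
  have gt: "h < j - i" using False ij(3) by simp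
  have 1: "linked (g ` {j..n - 1}) (g j) (g (n - 1))" using ij by (intro linked_path step) auto
  have 2: "linked (g ` {0..i}) (g 0) (g i)" using ij by (intro linked_path step) auto
  have 3: "linked ?A (g (n - 1)) (g 0)" using close ij by (intro linked_edge) auto
  have "linked ?A (g j) (g i)"
    by (rule linked_trans[OF linked_mono[OF 1] linked_trans[OF 3 linked_mono[OF 2]]]) (use ij in auto)
  moreover have "inj_on c ?A"
  proof (rule inj_onI)
    have main: "k = l" if "k \<in> {..i} \<union> {j..<n}" "l \<in> {..i} \<union> {j..<n}" "k mod h = l mod h" "k \<le> l" for k l
      using that gt n ij by (intro mod_eq_close[of k h l]) auto
    fix y z assume "y \<in> ?A" "z \<in> ?A" and eq: "c y = c z"
    then obtain k l where k: "y = g k" "z = g l" "k \<in> {..i} \<union> {j..<n}" "l \<in> {..i} \<union> {j..<n}"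
      by blast
    moreover have "k < n" "l < n" using k ij by auto
    ultimately have "k mod h = l mod h" using eq c by auto
    then have "k = l" using main[of k l] main[of l k] k by (cases "k \<le> l") auto
    then show "y = z" using k by simp
  qed
  moreover have "g i \<in> ?A" "g j \<in> ?A" using ij by auto
  ultimately show ?thesis using linked_sym[of ?A "g j" "g i"] by blast
qed

text \<open>Two indices that are not antipodal on a cycle of length \<open>2 h\<close> are joined by an arc
  of at most \<open>h\<close> consecutive vertices, and a vertex with two neighbours on the cycle has one that
  is not antipodal to a given index.\<close>

lemma dominating_cycle_colouring:
  assumes inj: "inj_on g {..<n}" and step: "\<And>i. Suc i < n \<Longrightarrow> g i \<sim> g (Suc i)"
    and close: "g (n - 1) \<sim> g 0" and n: "n \<le> 2 * h" "0 < h"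
    and dom: "\<And>u. u \<in> V \<Longrightarrow> (\<exists>i<n. i < h \<and> u \<sim> g i) \<or> (\<exists>i j. i < j \<and> j < n \<and> u \<sim> g i \<and> u \<sim> g j)"
  shows "\<exists>c. rainbow c \<and> c ` V \<subseteq> {..<h}"
proof -
  \<comment> \<open>Off the cycle this is an unspecified number below \<open>h\<close>; the walks
    built here leave the cycle only at their ends.\<close>
  define c where "c x = (the_inv_into {..<n} g x) mod h" for x
  have cg: "c (g i) = i mod h" if "i < n" for i
    using that inj by (simp add: c_def the_inv_into_f_f)
  have "\<exists>A. linked A u w \<and> inj_on c (A - {u, w})" if uw: "u \<in> V" "w \<in> V" for u w
  proof -
    obtain i j where ij: "i < n" "j < n" "u \<sim> g i" "w \<sim> g j" "j \<noteq> i + h" "i \<noteq> j + h"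
    proof -
      \<comment> \<open>The indices antipodal to \<open>j\<close> are \<open>j - h\<close> and
        \<open>j + h\<close>. They differ by \<open>2 * h \<ge> n\<close>, so \<open>i\<close> and
        \<open>i'\<close> cannot both be antipodal to \<open>j\<close>.\<close>
      have one: "\<exists>i<n. x \<sim> g i \<and> j \<noteq> i + h \<and> i \<noteq> j + h"
        if "i < i'" "i' < n" "x \<sim> g i" "x \<sim> g i'" for x i i' j
      proof (cases "j \<noteq> i + h \<and> i \<noteq> j + h")
        case True
        then show ?thesis using that by (intro exI[of _ i]) auto
      next
        case False
        then show ?thesis using that n by (intro exI[of _ i']) auto
      qed
      consider i j where "i < n" "i < h" "u \<sim> g i" "j < n" "j < h" "w \<sim> g j"
        | i i' j where "i < i'" "i' < n" "u \<sim> g i" "u \<sim> g i'" "j < n" "w \<sim> g j"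
        | i j j' where "i < n" "u \<sim> g i" "j < j'" "j' < n" "w \<sim> g j" "w \<sim> g j'"
        using dom[OF uw(1)] dom[OF uw(2)] less_trans by blast
      then show thesis
      proof cases
        case 1
        \<comment> \<open>Two indices below \<open>h\<close> differ by less than
          \<open>h\<close>.\<close>
        then show thesis by (intro that[of i j]) auto
      next
        case 2
        then show thesis using one[of i i' u j] that by blast
      next
        case 3
        then show thesis using one[of j j' w i] that by blast
      qed
    qed
    have arc: "\<exists>A. linked A (g k) (g l) \<and> inj_on c A \<and> g k \<in> A \<and> g l \<in> A"
      if "k \<le> l" "l < n" "l \<noteq> k + h" for k l
      using that by (intro cycle_arc[OF step close n(1) cg]) auto
    obtain A where A: "linked A (g i) (g j)" "inj_on c A" "g i \<in> A" "g j \<in> A"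
      using arc[of i j] arc[of j i] ij linked_sym[of _ "g j" "g i"] by (cases "i \<le> j") auto
    have "w \<sim> g j" using ij(4) .
    then have "linked ({u, w} \<union> A) (g j) w"
      using A(4) by (intro linked_edge) (simp_all add: adj_commute[of w])
    then have "linked ({u, w} \<union> A) (g i) w"
      by (rule linked_trans[OF linked_mono[OF A(1)], rotated]) auto
    then have "linked ({u, w} \<union> A) u w"
      by (rule linked_edge_trans[OF ij(3)]) (use A(3) in auto)
    moreover have "inj_on c ({u, w} \<union> A - {u, w})" by (rule inj_on_subset[OF A(2)]) auto
    ultimately show ?thesis by blast
  qed
  then have "rainbow c" unfolding rainbow_def by blast
  moreover have "c ` V \<subseteq> {..<h}" using n(2) by (auto simp: c_def)
  ultimately show ?thesis by blast
qed

section \<open>Neighbours of an induced path\<close>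

text \<open>Otherwise \<open>e j\<close> is the centre of an induced \<open>S122\<close>: the short
  leg is \<open>y\<close>, and the long legs run two steps along the path in either
  direction.\<close>

lemma induced_path_second_neighbour:
  assumes "\<And>i. i < m \<Longrightarrow> e i \<sim> e (Suc i)"
    and "\<And>i j. i + 2 \<le> j \<Longrightarrow> j \<le> m \<Longrightarrow> \<not> e i \<sim> e j"
    and "y \<sim> e j" "2 \<le> j" "j + 2 \<le> m"
  shows "\<exists>i\<le>m. i \<noteq> j \<and> y \<sim> e i"
proof (rule ccontr)
  assume neg: "\<not> ?thesis"
  obtain k where k: "j = Suc (Suc k)" using assms(4) by (metis le_Suc_ex add_2_eq_Suc)
  have "\<not> y \<sim> e i" if "i \<le> m" "i \<noteq> j" for i using neg that by blast
  then have "\<not> y \<sim> e k" "\<not> y \<sim> e (Suc k)" "\<not> y \<sim> e (Suc j)" "\<not> y \<sim> e (Suc (Suc j))"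
    using assms(5) k by simp_all
  then show False
    using no_S122[of "e j" y "e (Suc k)" "e k" "e (Suc j)" "e (Suc (Suc j))"] assms k
    by (simp add: adj_commute)
qed

text \<open>Domination passes from \<open>y\<close> to its neighbour \<open>w\<close>. Let
  \<open>p\<close> and \<open>q\<close> be the first and last neighbour index of \<open>y\<close>;
  they differ by the previous lemma. If \<open>w\<close> saw nothing of the path, then
  \<open>y\<close>, \<open>w\<close> and the path around \<open>p\<close> and \<open>q\<close> would
  give a net (\<open>q = p + 1\<close>) or an \<open>S122\<close> centred at \<open>y\<close>
  (\<open>q = p + 2\<close>).\<close>

lemma induced_path_dominates:
  assumes step: "\<And>i. i < m \<Longrightarrow> e i \<sim> e (Suc i)"
    and chordless: "\<And>i j. i + 2 \<le> j \<Longrightarrow> j \<le> m \<Longrightarrow> \<not> e i \<sim> e j"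
    and inner: "\<And>i. i \<le> m \<Longrightarrow> y \<sim> e i \<Longrightarrow> 2 \<le> i \<and> i + 2 \<le> m"
    and narrow: "\<And>i j. i \<le> m \<Longrightarrow> j \<le> m \<Longrightarrow> y \<sim> e i \<Longrightarrow> y \<sim> e j \<Longrightarrow> j \<le> i + 2"
    and "w \<sim> y" "y \<sim> e j" "j \<le> m"
  shows "\<exists>i\<le>m. w \<sim> e i"
proof (rule ccontr)
  assume neg: "\<not> ?thesis"
  define S where "S = {i. i \<le> m \<and> y \<sim> e i}"
  have fin: "finite S" "S \<noteq> {}" using assms(6,7) unfolding S_def by auto
  define p q where "p = Min S" and "q = Max S"
  have "p \<in> S" "q \<in> S" unfolding p_def q_def using fin by auto
  then have pq: "p \<le> m" "y \<sim> e p" "q \<le> m" "y \<sim> e q" "2 \<le> p" "q + 2 \<le> m" "q \<le> p + 2"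
    using inner narrow unfolding S_def by auto
  have only: "p \<le> i \<and> i \<le> q" if "i \<le> m" "y \<sim> e i" for i
    unfolding p_def q_def using that fin(1) by (auto simp: S_def intro: Min_le Max_ge)
  obtain i where "i \<le> m" "i \<noteq> p" "y \<sim> e i"
    using induced_path_second_neighbour[of m e y p] step chordless pq only by fastforce
  then have lt: "p < q" using only by fastforce
  obtain k where k: "p = Suc k" using pq by (cases p) auto
  have out: "\<not> y \<sim> e k" "\<not> y \<sim> e (Suc q)" using only[of k] only[of "Suc q"] k pq by auto
  have w: "\<not> w \<sim> e i" if "i \<le> m" for i using neg that by blast
  have ep: "e k \<sim> e p" "e q \<sim> e (Suc q)" using step k pq by auto
  have ch: "\<not> e k \<sim> e q" "\<not> e k \<sim> e (Suc q)" "\<not> e p \<sim> e (Suc q)" using chordless k pq lt by auto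
  consider "q = Suc p" | "q = Suc (Suc p)" using lt pq by linarith
  then show False
  proof cases
    case 1
    then have "e p \<sim> e q" using step pq by auto
    then show False
      using no_net[of y "e p" "e q" w "e k" "e (Suc q)"] ep ch out w[of k] w[of p] w[of q] w[of "Suc q"]
        pq k \<open>w \<sim> y\<close> by (simp add: adj_commute)
  next
    case 2
    then have "\<not> e p \<sim> e q" using chordless pq by auto
    then show False
      using no_S122[of y w "e p" "e k" "e q" "e (Suc q)"] ep ch out w[of k] w[of p] w[of q] w[of "Suc q"]
        pq k \<open>w \<sim> y\<close> by (simp add: adj_commute)
  qed
qed

end

section \<open>Layers around a diametral path\<close>

definition lev :: "'a rel \<Rightarrow> 'a set \<Rightarrow> 'a \<Rightarrow> nat" where
  "lev R P w = (LEAST n. \<exists>p \<in> P. (p, w) \<in> R ^^ n)"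

text \<open>The vertices reached from \<open>s\<close> by climbing one level per step. For
  \<open>s\<close> an end of the path these are its two sides, which may overlap. With
  \<open>R\<close> and \<open>P\<close> as parameters, reversing the path merely swaps the
  sides.\<close>

primrec layer :: "'a rel \<Rightarrow> 'a set \<Rightarrow> 'a \<Rightarrow> nat \<Rightarrow> 'a set" where
  "layer R P s 0 = {s}"
| "layer R P s (Suc k) = {w. lev R P w = Suc k \<and> (\<exists>y \<in> layer R P s k. (y, w) \<in> R)}"

locale diametral_path = S122_net_free_graph +
  fixes v :: "nat \<Rightarrow> 'a" and d :: nat
  assumes v_step: "i < d \<Longrightarrow> v i \<sim> v (Suc i)"
    and v_geodesic: "(v 0, v d) \<in> R ^^ n \<Longrightarrow> d \<le> n"
    and short: "x \<in> V \<Longrightarrow> y \<in> V \<Longrightarrow> \<exists>n\<le>d. (x, y) \<in> R ^^ n"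
    and d_ge_3: "3 \<le> d"
begin

abbreviation "P \<equiv> v ` {..d}"
abbreviation "level \<equiv> lev R P"
abbreviation "left \<equiv> layer R P (v 0)"
abbreviation "right \<equiv> layer R P (v d)"

lemma v_relpow: "i \<le> j \<Longrightarrow> j \<le> d \<Longrightarrow> (v i, v j) \<in> R ^^ (j - i)"
  by (rule relpow_path) (auto intro: v_step)

lemma v_V: "i \<le> d \<Longrightarrow> v i \<in> V"
  using v_step[of i] v_step[of "i - 1"] adj_V d_ge_3
  by (cases "i < d") auto

text \<open>Replacing the stretch from \<open>v i\<close> to \<open>v j\<close> by the given walk
  yields a walk from \<open>v 0\<close> to \<open>v d\<close>, which has length at least
  \<open>d\<close>.\<close>

lemma v_dist:
  assumes "(v i, v j) \<in> R ^^ n" "i \<le> d" "j \<le> d" shows "j \<le> i + n"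
proof (cases "i \<le> j")
  case True
  have "(v 0, v d) \<in> R ^^ ((i - 0) + n + (d - j))"
    using v_relpow[of 0 i] v_relpow[of j d] assms by (blast intro: relpow_addI)
  then show ?thesis using v_geodesic assms by fastforce
qed simp

lemma v_common: "x \<sim> v i \<Longrightarrow> x \<sim> v j \<Longrightarrow> i \<le> d \<Longrightarrow> j \<le> d \<Longrightarrow> j \<le> i + 2"
  using v_dist[of i j 2] adj_commute by (auto simp: numeral_2_eq_2)

lemma v_adj: "i \<le> d \<Longrightarrow> j \<le> d \<Longrightarrow> v i \<sim> v j \<longleftrightarrow> j = Suc i \<or> i = Suc j"
  using v_dist[of i j 1] v_dist[of j i 1] v_step[of i] v_step[of j] R_irrefl[of "v i"]
  by (auto simp: adj_commute le_Suc_eq)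

lemma v_inj: "i \<le> d \<Longrightarrow> j \<le> d \<Longrightarrow> v i = v j \<longleftrightarrow> i = j"
  using v_dist[of i j 0] v_dist[of j i 0] by auto

text \<open>Left-right symmetry: every fact about the left side transfers to the right side through
  this instance.\<close>

lemma reverse: "diametral_path V R (\<lambda>i. v (d - i)) d"
proof unfold_locales
  show "v (d - i) \<sim> v (d - Suc i)" if "i < d" for i
    using that by (subst v_adj) auto
  show "d \<le> n" if "(v (d - 0), v (d - d)) \<in> R ^^ n" for n
    using that v_geodesic relpow_sym by simp
qed (fact short d_ge_3)+

lemma reverse_P: "(\<lambda>i. v (d - i)) ` {..d} = P"
proof -
  have "(\<lambda>i. d - i) ` {..d} = {..d}"
    by (auto simp: image_iff) (metis atMost_iff diff_diff_cancel diff_le_self)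
  then show ?thesis by (metis image_image)
qed

lemma level_le: "p \<in> P \<Longrightarrow> (p, w) \<in> R ^^ n \<Longrightarrow> level w \<le> n"
  unfolding lev_def by (rule Least_le) blast

lemma level_witness: "w \<in> V \<Longrightarrow> \<exists>p\<in>P. (p, w) \<in> R ^^ level w"
  unfolding lev_def using short[of "v 0" w] v_V[of 0]
  by (intro LeastI_ex[of "\<lambda>n. \<exists>p \<in> P. (p, w) \<in> R ^^ n"]) auto

lemma level_adj: assumes "x \<sim> y" shows "level y \<le> Suc (level x)"
proof -
  obtain p where p: "p \<in> P" "(p, x) \<in> R ^^ level x"
    using level_witness[OF adj_V(1)[OF assms]] by blast
  show ?thesis using level_le[OF p(1) relpow_Suc_I[OF p(2) assms]] .
qed

lemma level_gap: "Suc (level x) < level y \<Longrightarrow> \<not> x \<sim> y"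
  using level_adj[of x y] by auto

lemma level_gap': "Suc (level x) < level y \<Longrightarrow> \<not> y \<sim> x"
  using level_gap adj_commute by blast

lemma level_v [simp]: "i \<le> d \<Longrightarrow> level (v i) = 0"
  using level_le[of "v i" "v i" 0] by auto

lemma level_0: "w \<in> V \<Longrightarrow> level w = 0 \<Longrightarrow> w \<in> P"
  using level_witness[of w] by auto

lemma level_parent:
  assumes "w \<in> V" "level w = Suc k" shows "\<exists>y. y \<sim> w \<and> level y = k"
proof -
  obtain p where p: "p \<in> P" "(p, w) \<in> R ^^ Suc k"
    using level_witness[OF assms(1)] assms(2) by auto
  from p(2) obtain y where y: "(p, y) \<in> R ^^ k" "y \<sim> w" by auto
  have "level y \<le> k" using level_le[OF p(1) y(1)] .
  with y show ?thesis using level_adj[of y w] assms(2) by auto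
qed

lemma level_1: "w \<in> V \<Longrightarrow> level w = 1 \<Longrightarrow> \<exists>i\<le>d. w \<sim> v i"
  using level_parent[of w 0] level_0 adj_V(1) by (force simp: adj_commute)

lemma left_level: "w \<in> left k \<Longrightarrow> level w = k"
  by (cases k) auto

lemma left_parent: "w \<in> left (Suc k) \<Longrightarrow> \<exists>y \<in> left k. y \<sim> w"
  by auto

text \<open>As \<open>x\<close> is adjacent to \<open>v 0\<close>, geodesy confines its neighbours
  on \<open>P\<close> to indices up to 2. Since \<open>d \<ge> 3\<close>, the edge from
  \<open>v a\<close> to \<open>v (Suc a)\<close> exists and supplies a leg for forbidden
  subgraphs.\<close>

lemma left_last_neighbour:
  assumes "x \<in> left 1"
  obtains a where "a \<le> 2" "x \<sim> v a" "\<And>i. a < i \<Longrightarrow> i \<le> d \<Longrightarrow> \<not> x \<sim> v i"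
proof -
  define S where "S = {i. i \<le> d \<and> x \<sim> v i}"
  have "finite S" "0 \<in> S" using assms unfolding S_def by (auto simp: adj_commute)
  then have "Max S \<in> S" by (auto intro: Max_in)
  show ?thesis
  proof (rule that)
    show "Max S \<le> 2" "x \<sim> v (Max S)"
      using v_common[of x 0 "Max S"] \<open>0 \<in> S\<close> \<open>Max S \<in> S\<close> by (auto simp: S_def)
    show "\<not> x \<sim> v i" if "Max S < i" "i \<le> d" for i
      using that Max_ge[OF \<open>finite S\<close>, of i] unfolding S_def by fastforce
  qed
qed

section \<open>Closeness of vertices of equal level on one side\<close>

text \<open>Otherwise \<open>u\<close> and \<open>u'\<close> have private parents \<open>x\<close>
  and \<open>x'\<close>. Comparing the last neighbours of these parents on \<open>P\<close>, and
  whether the parents are adjacent, always exhibits a net or an \<open>S122\<close>.\<close>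

lemma left_2_close:
  assumes "u \<in> left 2" "u' \<in> left 2"
  shows "u = u' \<or> u \<sim> u' \<or> (\<exists>x \<in> left 1. x \<sim> u \<and> x \<sim> u')"
proof (rule ccontr)
  assume neg: "\<not> ?thesis"
  have lu: "level u = 2" "level u' = 2" using assms by (simp_all add: left_level)
  have gap: "\<not> u \<sim> v i" "\<not> u' \<sim> v i" "\<not> v i \<sim> u" "\<not> v i \<sim> u'" if "i \<le> d" for i
    using that lu level_gap[of "v i"] level_gap'[of "v i"] by simp_all
  \<comment> \<open>Stated for \<open>w\<close>, \<open>w'\<close> in either order, so that
    \<open>a \<le> a'\<close> may be assumed.\<close>
  have main: False
    if x: "x \<in> left 1" "x \<sim> w" "x' \<in> left 1" "x' \<sim> w'" "\<not> x \<sim> w'" "\<not> x' \<sim> w"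
      and w: "{w, w'} = {u, u'}" "w \<noteq> w'"
      and a: "a \<le> 2" "x \<sim> v a" "\<And>i. a < i \<Longrightarrow> i \<le> d \<Longrightarrow> \<not> x \<sim> v i"
      and a': "a' \<le> 2" "x' \<sim> v a'" "\<And>i. a' < i \<Longrightarrow> i \<le> d \<Longrightarrow> \<not> x' \<sim> v i"
      and le: "a \<le> a'" for x x' w w' a a'
  proof -
    have ww: "\<not> w \<sim> w'" using w neg adj_commute[of u u'] by (auto simp: doubleton_eq_iff)
    have gw: "\<not> w \<sim> v i" "\<not> w' \<sim> v i" if "i \<le> d" for i
      using gap[OF that] w(1) by (auto simp: doubleton_eq_iff)
    have d: "Suc a' \<le> d" using a' d_ge_3 by simp
    have x0: "x \<sim> v 0" "x' \<sim> v 0" using x by (auto simp: adj_commute)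
    have vs: "v a' \<sim> v (Suc a')" using d v_adj by simp
    have n1: "\<not> x' \<sim> v (Suc a')" "\<not> x \<sim> v (Suc a')" using a a' le d by auto
    note facts = x ww gw[OF d] gw[of a'] x0 vs n1 d a'(2) R_irrefl
    show False
    proof (cases "a = a'")
      case True
      then have xa: "x \<sim> v a'" using a by simp
      show False
      proof (cases "x \<sim> x'")
        case True
        show False
          by (rule no_net[of "v a'" x x' "v (Suc a')" w w'])
            (use facts xa True in \<open>simp_all add: adj_commute\<close>)
      next
        case False
        show False
          by (rule no_S122[of "v a'" "v (Suc a')" x w x' w'])
            (use facts xa False in \<open>simp_all add: adj_commute\<close>)
      qed
    next
      case False
      then have lt: "a < a'" using le by simp
      have xa: "\<not> x \<sim> v a'" using a(3) lt d by simp
      show False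
      proof (cases "x \<sim> x'")
        case True
        show False
          by (rule no_S122[of x' w' x w "v a'" "v (Suc a')"])
            (use facts xa True in \<open>simp_all add: adj_commute\<close>)
      next
        case nx: False
        show False
        \<comment> \<open>Here \<open>a < a' \<le> 2\<close>. If \<open>a' = 1\<close>, then
          \<open>v 0\<close>, \<open>v 1\<close>, \<open>x'\<close> is the triangle of a net; if
          \<open>a' = 2\<close>, then \<open>x'\<close> is the centre of an \<open>S122\<close> with
          long legs \<open>v 2 v 3\<close> and \<open>v 0 x\<close>.\<close>
        proof (cases "a' = 1")
          case True
          have "v 0 \<sim> v 1" "\<not> v 0 \<sim> v 2" using v_adj[of 0 1] v_adj[of 0 2] d_ge_3 by simp_all
          then show False
            by (intro no_net[of "v 0" "v 1" x' x "v 2" w'])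
              (use facts xa nx True gw[of 0] in \<open>simp_all add: adj_commute numeral_2_eq_2\<close>)
        next
          case False
          then have "a' = 2" using lt a'(1) by simp
          moreover have "\<not> v 0 \<sim> v 2" "\<not> v 0 \<sim> v 3" using v_adj[of 0 3] v_adj[of 0 2] d_ge_3 by simp_all
          ultimately show False
            by (intro no_S122[of x' w' "v 2" "v 3" "v 0" x])
              (use facts xa nx gw[of 0] in \<open>simp_all add: adj_commute numeral_3_eq_3 numeral_2_eq_2\<close>)
        qed
      qed
    qed
  qed
  obtain x x' where x: "x \<in> left 1" "x \<sim> u" "x' \<in> left 1" "x' \<sim> u'"
    using assms by (auto simp: numeral_2_eq_2)
  then have x': "\<not> x \<sim> u'" "\<not> x' \<sim> u" using neg by blast+
  obtain a where a: "a \<le> 2" "x \<sim> v a" "\<And>i. a < i \<Longrightarrow> i \<le> d \<Longrightarrow> \<not> x \<sim> v i"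
    using left_last_neighbour x(1) by blast
  obtain a' where a': "a' \<le> 2" "x' \<sim> v a'" "\<And>i. a' < i \<Longrightarrow> i \<le> d \<Longrightarrow> \<not> x' \<sim> v i"
    using left_last_neighbour x(3) by blast
  show False
  proof (cases "a \<le> a'")
    case True
    show False by (rule main[of x u x' u' a a']) (use x x' a a' True neg in blast)+
  next
    case False
    show False by (rule main[of x' u' x u a' a]) (use x x' a a' False neg in auto)
  qed
qed

text \<open>Let \<open>y\<close>, \<open>y'\<close> be private parents of \<open>u\<close>,
  \<open>u'\<close>. A common parent \<open>x\<close> of them, together with a parent
  \<open>p\<close> of \<open>x\<close>, gives a net or an \<open>S122\<close> centred at
  \<open>x\<close>. Without one, \<open>y\<close> and \<open>y'\<close> are adjacent by
  \<open>IH\<close>, and \<open>y\<close> is the centre of an \<open>S122\<close> with long legs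
  \<open>x p\<close> and \<open>y' u'\<close>.\<close>

lemma left_close_Suc:
  assumes IH: "\<And>y y'. y \<in> left (Suc (Suc k)) \<Longrightarrow> y' \<in> left (Suc (Suc k)) \<Longrightarrow>
      y = y' \<or> y \<sim> y' \<or> (\<exists>x \<in> left (Suc k). x \<sim> y \<and> x \<sim> y')"
    and u: "u \<in> left (Suc (Suc (Suc k)))" "u' \<in> left (Suc (Suc (Suc k)))"
  shows "u = u' \<or> u \<sim> u' \<or> (\<exists>y \<in> left (Suc (Suc k)). y \<sim> u \<and> y \<sim> u')"
proof (rule ccontr)
  assume neg: "\<not> ?thesis"
  obtain y y' where y: "y \<in> left (Suc (Suc k))" "y \<sim> u" "y' \<in> left (Suc (Suc k))" "y' \<sim> u'"
    using u left_parent by blast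
  have n: "\<not> y \<sim> u'" "\<not> y' \<sim> u" "\<not> u \<sim> u'" "y \<noteq> y'" using neg y by blast+
  have lv: "level u = k + 3" "level u' = k + 3" "level y = k + 2" "level y' = k + 2"
    using left_level[OF u(1)] left_level[OF u(2)] left_level[OF y(1)] left_level[OF y(3)] by simp_all
  show False
  proof (cases "\<exists>x \<in> left (Suc k). x \<sim> y \<and> x \<sim> y'")
    case True
    then obtain x p where x: "x \<in> left (Suc k)" "x \<sim> y" "x \<sim> y'" "p \<in> left k" "p \<sim> x"
      using left_parent by blast
    have "level x = k + 1" "level p = k" using left_level[OF x(1)] left_level[of p k] x by simp_all
    then have g: "\<not> p \<sim> y" "\<not> p \<sim> y'" "\<not> p \<sim> u" "\<not> p \<sim> u'" "\<not> x \<sim> u" "\<not> x \<sim> u'"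
      using lv by (auto intro!: level_gap)
    show False
    proof (cases "y \<sim> y'")
      case True
      show False
        by (rule no_net[of x y y' p u u']) (use x y n g True in \<open>simp_all add: adj_commute\<close>)
    next
      case False
      show False
        by (rule no_S122[of x p y u y' u']) (use x y n g False in \<open>simp_all add: adj_commute\<close>)
    qed
  next
    case False
    then have yy: "y \<sim> y'" using IH[OF y(1,3)] n by blast
    obtain x p where x: "x \<in> left (Suc k)" "x \<sim> y" "p \<in> left k" "p \<sim> x"
      using left_parent y(1) by blast
    then have xy: "\<not> x \<sim> y'" using False by blast
    have "level x = k + 1" "level p = k" using left_level[OF x(1)] left_level[of p k] x by simp_all
    then have g: "\<not> p \<sim> y" "\<not> p \<sim> y'" "\<not> p \<sim> u" "\<not> p \<sim> u'" "\<not> x \<sim> u" "\<not> x \<sim> u'"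
      using lv by (auto intro!: level_gap)
    show False
      by (rule no_S122[of y u x p y' u']) (use x y n g xy yy in \<open>simp_all add: adj_commute\<close>)
  qed
qed

text \<open>At level 1 the common parent is \<open>v 0\<close>. Level 2 has no room for two further
  layers below its parents, so \<open>P\<close> itself supplies the forbidden subgraphs there; from
  level 3 on the layers do.\<close>

lemma left_close:
  "u \<in> left (Suc k) \<Longrightarrow> u' \<in> left (Suc k) \<Longrightarrow>
    u = u' \<or> u \<sim> u' \<or> (\<exists>y \<in> left k. y \<sim> u \<and> y \<sim> u')"
proof (induction k arbitrary: u u')
  case (Suc k)
  show ?case
  proof (cases k)
    case 0
    then show ?thesis using left_2_close[of u u'] Suc.prems by (simp only: numeral_2_eq_2 One_nat_def)
  next
    case (Suc k')
    show ?thesis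
      using left_close_Suc[of k' u u'] Suc.IH Suc.prems unfolding Suc by blast
  qed
qed auto

section \<open>Every vertex of level at least 2 belongs to a side\<close>

lemma neighbour_interval:
  assumes "x \<sim> v i" "i \<le> d"
  obtains a b where "a \<le> b" "b \<le> a + 2" "b \<le> d" "x \<sim> v a" "x \<sim> v b"
    "\<And>j. j \<le> d \<Longrightarrow> x \<sim> v j \<Longrightarrow> a \<le> j \<and> j \<le> b"
proof -
  define S where "S = {j. j \<le> d \<and> x \<sim> v j}"
  have S: "finite S" "i \<in> S" using assms unfolding S_def by auto
  then have m: "Min S \<in> S" "Max S \<in> S" by (auto intro: Min_in Max_in)
  show ?thesis
  proof (rule that)
    show "x \<sim> v (Min S)" "x \<sim> v (Max S)" "Max S \<le> d" using m by (auto simp: S_def)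
    show "Min S \<le> Max S" using Min_le[OF S(1) m(2)] .
    show "Max S \<le> Min S + 2" using m v_common unfolding S_def by blast
    show "Min S \<le> j \<and> j \<le> Max S" if "j \<le> d" "x \<sim> v j" for j
      using that Min_le[OF S(1), of j] Max_ge[OF S(1), of j] unfolding S_def by auto
  qed
qed

text \<open>If \<open>x\<close> misses both ends of \<open>P\<close>, its neighbours there span an
  interval from \<open>a\<close> to \<open>b\<close> strictly inside \<open>P\<close>. Its width 0,
  1 or 2 yields an \<open>S122\<close> centred at \<open>v a\<close>, a net on \<open>x\<close>,
  \<open>v a\<close>, \<open>v b\<close>, or an \<open>S122\<close> centred at
  \<open>x\<close>.\<close>

lemma parent_side:
  assumes "x \<sim> w" "level x = 1" "level w = 2"
  shows "x \<in> left 1 \<union> right 1"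
proof (rule ccontr)
  assume "\<not> ?thesis"
  then have ends: "\<not> x \<sim> v 0" "\<not> x \<sim> v d"
    using assms by (auto simp: adj_commute)
  obtain i where "i \<le> d" "x \<sim> v i" using level_1 assms adj_V(1) by blast
  then obtain a b where ab: "a \<le> b" "b \<le> a + 2" "b \<le> d" "x \<sim> v a" "x \<sim> v b"
    and only: "\<And>j. j \<le> d \<Longrightarrow> x \<sim> v j \<Longrightarrow> a \<le> j \<and> j \<le> b"
    using neighbour_interval by blast
  have a: "1 \<le> a" "b < d" using ab ends by (cases "a = 0"; cases "b = d"; simp)+
  have gap: "\<not> w \<sim> v j" if "j \<le> d" for j
    using that assms level_gap'[of "v j" w] by simp
  have out: "\<not> x \<sim> v j" if "j \<le> d" "j < a \<or> b < j" for j using only that by fastforce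
  consider "b = a" | "b = a + 1" | "b = a + 2" using ab by linarith
  then show False
  proof cases
    case 1
    show False
    proof (cases "2 \<le> a")
      case True
      show False
        by (rule no_S122[of "v a" "v (Suc a)" x w "v (a - 1)" "v (a - 2)"])
          (use True 1 a assms ab gap out in \<open>auto simp: adj_commute v_adj\<close>)
    next
      case False
      \<comment> \<open>Now \<open>a = 1\<close>, too close to the left end for a leg of length 2;
        as \<open>d \<ge> 3\<close>, that leg can run to \<open>v 3\<close> instead.\<close>
      show False
        by (rule no_S122[of "v a" "v (a - 1)" x w "v (Suc a)" "v (a + 2)"])
          (use False 1 a assms ab gap out d_ge_3 in \<open>auto simp: adj_commute v_adj\<close>)
    qed
  next
    case 2
    show False
      by (rule no_net[of x "v a" "v b" w "v (a - 1)" "v (Suc b)"])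
        (use 2 a assms ab gap out in \<open>auto simp: adj_commute v_adj\<close>)
  next
    case 3
    show False
      by (rule no_S122[of x w "v a" "v (a - 1)" "v b" "v (Suc b)"])
        (use 3 a assms ab gap out in \<open>auto simp: adj_commute v_adj\<close>)
  qed
qed

lemma side:
  "w \<in> V \<Longrightarrow> level w = k + 2 \<Longrightarrow> w \<in> left (k + 2) \<union> right (k + 2)"
proof (induction k arbitrary: w)
  case 0
  then obtain x where "x \<sim> w" "level x = 1" using level_parent[of w 1] by auto
  with parent_side[of x w] 0 show ?case by (auto simp: numeral_2_eq_2 simp del: layer.simps(1))
next
  case (Suc k)
  then obtain x where "x \<sim> w" "level x = k + 2" using level_parent[of w "k + 2"] by auto
  with Suc.IH[of x] Suc.prems adj_V(1)[of x w] show ?case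
    by (auto simp del: layer.simps simp: layer.simps(2)[of _ _ _ "Suc (Suc k)"])
qed

section \<open>Walks with pairwise distinct levels\<close>

lemma right_level: "w \<in> right k \<Longrightarrow> level w = k"
  using diametral_path.left_level[OF reverse] unfolding reverse_P diff_zero .

lemma left_V: "w \<in> left k \<Longrightarrow> w \<in> V"
  using v_V[of 0] adj_V(2) by (cases k) auto

lemma right_V: "w \<in> right k \<Longrightarrow> w \<in> V"
  using diametral_path.left_V[OF reverse] unfolding reverse_P diff_zero .

text \<open>\<open>C\<close> is a chain of parents from \<open>w\<close> down to \<open>s\<close>.
  Membership in the side of another end \<open>t\<close> is inherited upwards along the chain, so
  the chain of a vertex outside that side avoids that side altogether.\<close>

lemma layer_descent:
  assumes "level s = 0" "w \<in> layer R P s k"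
  shows "\<exists>C \<subseteq> (\<Union>i<k. layer R P s i). inj_on level C \<and> linked (insert w C) w s
    \<and> (\<forall>x\<in>C. \<forall>t. x \<in> layer R P t (level x) \<longrightarrow> w \<in> layer R P t k)"
  using assms(2)
proof (induction k arbitrary: w)
  case (Suc k)
  have lv: "level x = i" if "x \<in> layer R P s i" for x i
    using that assms(1) by (cases i) auto
  obtain y where y: "y \<in> layer R P s k" "y \<sim> w" "level w = Suc k" using Suc.prems by auto
  then obtain C where C: "C \<subseteq> (\<Union>i<k. layer R P s i)" "inj_on level C" "linked (insert y C) y s"
    "\<And>x t. x \<in> C \<Longrightarrow> x \<in> layer R P t (level x) \<Longrightarrow> y \<in> layer R P t k"
    using Suc.IH[OF y(1)] by blast
  have up: "w \<in> layer R P t (Suc k)" if "y \<in> layer R P t k" for t using that y by auto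
  have "linked (insert w (insert y C)) w s"
    using y C(3) by (intro linked_edge_trans[of w y]) (auto simp: adj_commute elim: linked_mono)
  moreover have "level x < k" if "x \<in> C" for x using that C(1) lv by fastforce
  then have "inj_on level (insert y C)"
    using C(2) lv[OF y(1)] by (intro inj_on_insert_less) auto
  moreover have "insert y C \<subseteq> (\<Union>i<Suc k. layer R P s i)"
    using C(1) y(1) by (simp add: lessThan_Suc) blast
  moreover have "\<forall>x\<in>insert y C. \<forall>t. x \<in> layer R P t (level x) \<longrightarrow> w \<in> layer R P t (Suc k)"
    using C(4) up lv[OF y(1)] by blast
  ultimately show ?case by blast
qed auto

text \<open>Descend from \<open>w\<close> to the level of \<open>u\<close>; by
  \<open>left_close\<close> at most one further vertex, one level lower, completes the connection.
  So no level repeats among the inner vertices.\<close>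

lemma left_linked:
  assumes "u \<in> left (Suc k)" "w \<in> left (Suc k + j)"
  shows "\<exists>C \<subseteq> (\<Union>i<Suc k + j. left i). inj_on level C \<and> linked ({u, w} \<union> C) u w"
  using assms(2)
proof (induction j arbitrary: w)
  case 0
  then consider "u = w" | "u \<sim> w" | y where "y \<in> left k" "y \<sim> u" "y \<sim> w"
    using left_close[of u k w] assms(1) by auto
  then show ?case
  proof cases
    case 1
    then show ?thesis by (intro exI[of _ "{}"]) auto
  next
    case 2
    then show ?thesis by (intro exI[of _ "{}"]) (auto intro: linked_edge)
  next
    case 3
    then have "linked {u, w, y} u w"
      by (intro linked_edge_trans[of u y] linked_edge) (auto simp: adj_commute)
    with 3(1) show ?thesis by (intro exI[of _ "{y}"]) (auto simp: insert_commute)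
  qed
next
  case (Suc j)
  then obtain y where y: "y \<in> left (Suc k + j)" "y \<sim> w" by auto
  then obtain C where C: "C \<subseteq> (\<Union>i<Suc k + j. left i)" "inj_on level C" "linked ({u, y} \<union> C) u y"
    using Suc.IH[OF y(1)] by blast
  have "linked ({u, w} \<union> insert y C) u w"
    using y by (intro linked_trans[OF linked_mono[OF C(3)] linked_edge]) auto
  moreover have "level x < Suc k + j" if "x \<in> C" for x using that C(1) left_level by blast
  then have "inj_on level (insert y C)"
    using C(2) left_level[OF y(1)] by (intro inj_on_insert_less) auto
  moreover have "insert y C \<subseteq> (\<Union>i<Suc k + Suc j. left i)"
    using C(1) y(1) by (simp add: lessThan_Suc del: layer.simps) blast
  ultimately show ?case by blast
qed

lemma right_linked:
  assumes "u \<in> right (Suc k)" "w \<in> right (Suc k + j)"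
  shows "\<exists>C \<subseteq> (\<Union>i<Suc k + j. right i). inj_on level C \<and> linked ({u, w} \<union> C) u w"
  using diametral_path.left_linked[OF reverse, unfolded reverse_P diff_zero] assms by blast

lemma path_linked: "i \<le> d \<Longrightarrow> j \<le> d \<Longrightarrow> linked P (v i) (v j)"
proof (induction i j rule: linorder_wlog)
  case (le i j)
  have "linked (v ` {i..j}) (v i) (v j)" using le by (intro linked_path v_step) auto
  then show ?case by (rule linked_mono) (use le in auto)
qed (blast intro: linked_sym)

lemma near_path_linked:
  assumes "u \<in> V" "level u \<le> 1" "i \<le> d" shows "linked (insert u P) u (v i)"
proof -
  consider "u \<in> P" | j where "j \<le> d" "u \<sim> v j"
    using level_0[OF assms(1)] level_1[OF assms(1)] assms(2) by (cases "level u") auto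
  then show ?thesis
  proof cases
    case 1
    then show ?thesis using path_linked assms(3) by (auto elim: linked_mono)
  next
    case 2
    then show ?thesis
      by (intro linked_edge_trans[OF 2(2) linked_mono[OF path_linked[OF 2(1) assms(3)]]]) auto
  qed
qed

lemma level_ge_2: "w \<in> V \<Longrightarrow> 2 \<le> level w \<Longrightarrow> w \<in> left (level w) \<union> right (level w)"
  using side[of w "level w - 2"] by (simp only: le_add_diff_inverse2)

section \<open>The colouring by levels with \<open>d + 11\<close> colours\<close>

lemma layered_colouring:
  assumes low: "\<And>w. w \<in> V \<Longrightarrow> level w \<le> 6"
  shows "\<exists>c. rainbow c \<and> c ` V \<subseteq> {..<d + 11}"
proof -
  \<comment> \<open>Indices \<open>0\<close> to \<open>d\<close> on \<open>P\<close>,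
    \<open>d + 1\<close> to \<open>d + 5\<close> for levels 1 to 5 on the left, \<open>d + 6\<close>
    to \<open>d + 10\<close> for the other vertices of these levels. Vertices of level 6 occur only
    as ends of walks and can reuse colour 0. A vertex on both sides counts as left.\<close>
  define c where "c x = (if level x = 0 then the_inv_into {..d} v x else if level x = 6 then 0
    else if x \<in> left (level x) then d + level x else d + 5 + level x)" for x
  have inj_v: "inj_on v {..d}" using v_inj by (auto simp: inj_on_def)
  have cv: "c (v i) = i" if "i \<le> d" for i
    using that the_inv_into_f_f[OF inj_v] by (simp add: c_def)
  have c0: "c x \<le> d" if "x \<in> V" "level x = 0" for x
    using level_0[OF that] cv by auto
  have "c ` V \<subseteq> {..<d + 11}"
  proof safe
    fix x assume x: "x \<in> V"
    then show "c x < d + 11" using c0[OF x] low[OF x] by (cases "level x = 0") (auto simp: c_def)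
  qed
  \<comment> \<open>Below level 6 the colour determines the level and, off \<open>P\<close>, whether
    the vertex counts as left.\<close>
  moreover have same_level: "level x = level y" "level x > 0 \<longrightarrow> (x \<in> left (level x) \<longleftrightarrow> y \<in> left (level y))"
    if "x \<in> V" "y \<in> V" "level x \<le> 5" "level y \<le> 5" "c x = c y" for x y
    using that c0[of x] c0[of y] unfolding c_def by (auto split: if_splits)
  have inj1: "inj_on c C" if "C \<subseteq> V" "inj_on level C" "\<And>x. x \<in> C \<Longrightarrow> level x \<le> 5" for C
  proof (rule inj_onI)
    fix x y assume "x \<in> C" "y \<in> C" "c x = c y"
    then show "x = y" using that(1,3) same_level(1)[of x y] inj_onD[OF that(2), of x y] by blast
  qed
  \<comment> \<open>For walks that descend to \<open>P\<close>, run along it and possibly climb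
    again: the two chains use disjoint sets of colours.\<close>
  have inj2: "inj_on c (P \<union> C \<union> C')"
    if C: "C \<subseteq> V" "inj_on level C" "\<And>x. x \<in> C \<Longrightarrow> level x \<le> 5"
      and C': "C' \<subseteq> V" "inj_on level C'" "\<And>x. x \<in> C' \<Longrightarrow> level x \<le> 5"
      and lr: "\<And>x y. x \<in> C \<Longrightarrow> y \<in> C' \<Longrightarrow> x \<in> left (level x) \<and> y \<notin> left (level y)" for C C'
  proof (rule inj_onI)
    fix x y assume xy: "x \<in> P \<union> C \<union> C'" "y \<in> P \<union> C \<union> C'" "c x = c y"
    have mem: "z \<in> V \<and> level z \<le> 5" if "z \<in> P \<union> C \<union> C'" for z
      using that C(1,3) C'(1,3) v_V by auto
    have V: "x \<in> V" "y \<in> V" "level x \<le> 5" "level y \<le> 5"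
      using mem[OF xy(1)] mem[OF xy(2)] by auto
    note sl = same_level[OF V xy(3)]
    show "x = y"
    proof (cases "level x = 0")
      case True
      then have "x \<in> P" "y \<in> P" using V sl level_0 by auto
      then show ?thesis using xy(3) cv by auto
    next
      case False
      then have "x \<in> C \<union> C'" "y \<in> C \<union> C'" using sl xy(1,2) by auto
      then show ?thesis
        using sl False lr[of x y] lr[of y x] C(2) C'(2) by (auto dest: inj_onD)
    qed
  qed
  have "rainbow c" unfolding rainbow_def
  proof (intro ballI impI)
    have main: "\<exists>A. linked A u w \<and> inj_on c (A - {u, w})"
      if uw: "u \<in> V" "w \<in> V" "level u \<le> level w" for u w
    proof (cases "level u \<le> 1")
      case lu: True
      \<comment> \<open>\<open>u\<close> is on or next to \<open>P\<close>, so the walk follows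
        \<open>P\<close> to the end \<open>v i\<close> and climbs from there to \<open>w\<close>;
        \<open>i\<close> will be \<open>0\<close> or \<open>d\<close>.\<close>
      have ex: "\<exists>A. linked A u w \<and> inj_on c (A - {u, w})" 
        if s: "i \<le> d" "w \<in> layer R P (v i) (level w)"
        and sub: "\<And>k. layer R P (v i) k \<subseteq> V \<and> (\<forall>x\<in>layer R P (v i) k. level x = k)" for i
      proof -
        obtain C where C: "C \<subseteq> (\<Union>k<level w. layer R P (v i) k)" "inj_on level C"
          "linked (insert w C) w (v i)"
          using layer_descent[OF _ s(2)] s(1) by auto
        have "linked (insert u (insert w (P \<union> C))) u w"
          by (rule linked_trans[OF linked_mono[OF near_path_linked[OF uw(1) lu s(1)]]
                linked_mono[OF linked_sym[OF C(3)]]]) auto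
        moreover have "x \<in> V \<and> level x \<le> 5" if "x \<in> C" for x
          using that C(1) sub low[OF uw(2)] by fastforce
        then have "inj_on c (P \<union> C)" using inj2[of C "{}"] C(2) by auto
        then have "inj_on c (insert u (insert w (P \<union> C)) - {u, w})" by (rule inj_on_subset) auto
        ultimately show ?thesis by blast
      qed
      show ?thesis
      proof (cases "level w \<le> 1")
        case True
        have "linked (insert u (insert w P)) u w"
          by (rule linked_trans[OF linked_mono[OF near_path_linked[OF uw(1) lu, of 0]]
                linked_mono[OF linked_sym[OF near_path_linked[OF uw(2) True, of 0]]]]) auto
        moreover have "inj_on c (insert u (insert w P) - {u, w})"
          by (rule inj_on_subset[OF inj2[of "{}" "{}"]]) auto
        ultimately show ?thesis by blast
      next
        case False
        then consider "w \<in> left (level w)" | "w \<in> right (level w)"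
          using level_ge_2[OF uw(2)] by force
        then show ?thesis
        proof cases
          case 1
          then show ?thesis using left_level left_V by (intro ex[of 0]) blast+
        next
          case 2
          then show ?thesis using right_level right_V by (intro ex[of d]) blast+
        qed
      qed
    next
      case False
      define k j where "k = level u - 1" and "j = level w - level u"
      then have k: "level u = Suc k" "level w = Suc k + j" using False uw(3) by auto
      have sides: "u \<in> left (level u) \<union> right (level u)" "w \<in> left (level w) \<union> right (level w)"
        using level_ge_2[OF uw(1)] level_ge_2[OF uw(2)] uw(3) False by simp_all
      have same: ?thesis if "C \<subseteq> V" "inj_on level C" "\<forall>x\<in>C. level x < level w"
        "linked ({u, w} \<union> C) u w" for C
      proof -
        have "level x \<le> 5" if "x \<in> C" for x
          using that \<open>\<forall>x\<in>C. level x < level w\<close> low[OF uw(2)] by fastforce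
        then have "inj_on c ({u, w} \<union> C - {u, w})"
          by (intro inj_on_subset[OF inj1[of C]] that) auto
        with that(4) show ?thesis by blast
      qed
      have opposite: "\<exists>A. linked A x y \<and> inj_on c (A - {x, y})"
        if x: "x \<in> V" "x \<in> left (level x)" and y: "y \<in> V" "y \<in> right (level y)" "y \<notin> left (level y)" for x y
      proof -
        obtain C where C: "C \<subseteq> (\<Union>k<level x. left k)" "inj_on level C" "linked (insert x C) x (v 0)"
          using layer_descent[OF _ x(2)] by auto
        \<comment> \<open>As \<open>y\<close> is not on the left, the last fact keeps all of
          \<open>C'\<close> off the left side.\<close>
        obtain C' where C': "C' \<subseteq> (\<Union>k<level y. right k)" "inj_on level C'" "linked (insert y C') y (v d)"
          "\<And>z. z \<in> C' \<Longrightarrow> z \<in> left (level z) \<Longrightarrow> y \<in> left (level y)"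
          using layer_descent[OF _ y(2)] by auto
        have "linked (insert x (insert y (P \<union> C \<union> C'))) x y"
          by (rule linked_trans[OF linked_mono[OF C(3)] linked_trans[OF linked_mono[OF path_linked[of 0 d]]
                linked_mono[OF linked_sym[OF C'(3)]]]]) auto
        moreover have "z \<in> V \<and> level z \<le> 5 \<and> z \<in> left (level z)" if "z \<in> C" for z
          using that C(1) low[OF x(1)] left_level left_V by fastforce
        moreover have "z \<in> V \<and> level z \<le> 5 \<and> z \<notin> left (level z)" if "z \<in> C'" for z
          using that C'(1,4) low[OF y(1)] y(3) right_level right_V by fastforce
        ultimately have "linked (insert x (insert y (P \<union> C \<union> C'))) x y" "inj_on c (P \<union> C \<union> C')"
          using C(2) C'(2) by (auto intro!: inj2)
        then show ?thesis
          by (intro exI[of _ "insert x (insert y (P \<union> C \<union> C'))"]) (auto elim: inj_on_subset)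
      qed
      consider "u \<in> left (level u)" "w \<in> left (level w)" | "u \<in> right (level u)" "w \<in> right (level w)"
        | "u \<in> left (level u)" "w \<in> right (level w)" "w \<notin> left (level w)"
        | "w \<in> left (level w)" "u \<in> right (level u)" "u \<notin> left (level u)"
        using sides by blast
      then show ?thesis
      proof cases
        case 1
        then obtain C where "C \<subseteq> (\<Union>i<level w. left i)" "inj_on level C" "linked ({u, w} \<union> C) u w"
          using left_linked[of u k w j] k by auto
        then show ?thesis using left_V left_level by (intro same[of C]) fastforce+
      next
        case 2
        then obtain C where "C \<subseteq> (\<Union>i<level w. right i)" "inj_on level C" "linked ({u, w} \<union> C) u w"
          using right_linked[of u k w j] k by auto
        then show ?thesis using right_V right_level by (intro same[of C]) fastforce+
      next
        case 3
        then show ?thesis using opposite uw by blast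
      next
        case 4
        then obtain A where "linked A w u" "inj_on c (A - {w, u})" using opposite uw by blast
        then show ?thesis using linked_sym by (metis insert_commute)
      qed
    qed
    fix u w assume uw: "u \<in> V" "w \<in> V" "u \<noteq> w"
    show "\<exists>A. linked A u w \<and> inj_on c (A - {u, w})"
    proof (cases "level u \<le> level w")
      case True then show ?thesis using main uw by blast
    next
      case False
      then obtain A where "linked A w u" "inj_on c (A - {w, u})" using main[of w u] uw by auto
      then show ?thesis using linked_sym by (metis insert_commute)
    qed
  qed
  ultimately show ?thesis by blast
qed

section \<open>Vertices far from the path\<close>

abbreviation "U \<equiv> {w \<in> V. 2 \<le> level w}"
abbreviation "W \<equiv> Restr R U"

lemma W_sub: "W \<subseteq> R" by auto

lemma W_sym: "(x, y) \<in> W ^^ n \<Longrightarrow> (y, x) \<in> W ^^ n"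
proof (rule relpow_symI)
  show "sym W" using R_sym by (auto simp: sym_def)
qed

lemma level_relpow: assumes "(x, y) \<in> R ^^ n" "x \<in> V" shows "level y \<le> level x + n"
proof -
  obtain p where "p \<in> P" "(p, x) \<in> R ^^ level x" using level_witness assms(2) by blast
  then show ?thesis using level_le[OF _ relpow_addI[OF _ assms(1)]] by blast
qed

text \<open>Split the walk where it first leaves \<open>U\<close>, at \<open>a\<close>: the next
  vertex has level 1 and, by \<open>parent_side\<close>, is adjacent to an end of \<open>P\<close>.
  From that end the remaining \<open>k\<close> steps reach \<open>v i\<close> in
  \<open>k + 1\<close> steps, so geodesy bounds \<open>i\<close>.\<close>

lemma walk_to_path:
  assumes "(u, v i) \<in> R ^^ n" "u \<in> U" "i \<le> d"
  shows "\<exists>t k a. (u, a) \<in> W ^^ t \<and> n = t + 1 + k \<and> 1 \<le> k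
    \<and> (a \<in> left 2 \<and> i \<le> k + 1 \<or> a \<in> right 2 \<and> d \<le> i + k + 1)"
  using assms(1,2)
proof (induction n arbitrary: u)
  case 0
  then show ?case using assms(3) by simp
next
  case (Suc n)
  obtain y where y: "u \<sim> y" "(y, v i) \<in> R ^^ n" using Suc.prems(1) relpow_Suc_D2 by metis
  show ?case
  proof (cases "y \<in> U")
    case True
    then obtain t k a where tk: "(y, a) \<in> W ^^ t" "n = t + 1 + k" "1 \<le> k"
      "a \<in> left 2 \<and> i \<le> k + 1 \<or> a \<in> right 2 \<and> d \<le> i + k + 1"
      using Suc.IH[OF y(2)] by blast
    have "(u, a) \<in> W ^^ Suc t"
      using y(1) True Suc.prems(2) tk(1) by (intro relpow_Suc_I2[of u y]) auto
    then show ?thesis using tk by (intro exI[of _ "Suc t"] exI[of _ k] exI[of _ a]) auto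
  next
    case False
    then have lv: "level y = 1" "level u = 2"
      using level_adj[of u y] level_adj[of y u] y(1) Suc.prems(2) adj_V adj_commute by fastforce+
    have "1 \<le> n" using level_relpow[OF relpow_sym[OF y(2)] v_V[OF assms(3)]] lv assms(3) by simp
    have "y \<in> left 1 \<union> right 1" using parent_side[of y u] y(1) lv by (simp only: adj_commute)
    then have "u \<in> left 2 \<and> i \<le> n + 1 \<or> u \<in> right 2 \<and> d \<le> i + n + 1"
    proof
      assume L: "y \<in> left 1"
      then have "u \<in> left 2" using y(1) lv by (auto simp: numeral_2_eq_2 adj_commute)
      moreover have "(v 0, v i) \<in> R ^^ Suc n"
        using L y(2) by (intro relpow_Suc_I2[of _ y]) auto
      ultimately show ?thesis using v_dist[of 0 i "Suc n"] assms(3) by auto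
    next
      assume L: "y \<in> right 1"
      then have "u \<in> right 2" using y(1) lv by (auto simp: numeral_2_eq_2 adj_commute)
      moreover have "(v d, v i) \<in> R ^^ Suc n"
        using L y(2) by (intro relpow_Suc_I2[of _ y]) auto
      ultimately show ?thesis using v_dist[OF relpow_sym, of d i "Suc n"] assms(3) by auto
    qed
    then show ?thesis using \<open>1 \<le> n\<close> by (intro exI[of _ 0] exI[of _ n] exI[of _ u]) auto
  qed
qed

text \<open>Otherwise \<open>w\<close> and \<open>s\<close> have a common parent \<open>x\<close>,
  not adjacent to \<open>s'\<close> because \<open>s'\<close> is outside \<open>left 2\<close>. Then
  \<open>x\<close> is the centre of an \<open>S122\<close> with short leg \<open>w\<close> and long
  legs \<open>s s'\<close> and \<open>v a v (Suc a)\<close>.\<close>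

lemma left_2_dominated:
  assumes "w \<in> left 2" "s \<in> left 2" "s \<sim> s'" "s' \<in> U" "s' \<notin> left 2"
  shows "w \<sim> s \<or> w \<sim> s'"
proof (rule ccontr)
  assume neg: "\<not> ?thesis"
  then have "w \<noteq> s" using assms(3) by blast
  then obtain x where x: "x \<in> left 1" "x \<sim> w" "x \<sim> s"
    using left_2_close[OF assms(1,2)] neg by blast
  obtain a where a: "a \<le> 2" "x \<sim> v a" "\<And>i. a < i \<Longrightarrow> i \<le> d \<Longrightarrow> \<not> x \<sim> v i"
    using left_last_neighbour[OF x(1)] by blast
  have lv: "level x = 1" "level w = 2" "level s = 2"
    using left_level[OF x(1)] left_level[OF assms(1)] left_level[OF assms(2)] by simp_all
  have "\<not> x \<sim> s'"
  proof
    assume xs: "x \<sim> s'"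
    then have "level s' = 2" using level_adj[OF xs] lv assms(4) by simp
    then show False using xs x(1) assms(5) by (auto simp: numeral_2_eq_2)
  qed
  moreover have "\<not> z \<sim> v i" if "z \<in> {w, s, s'}" "i \<le> d" for z i
    using that lv assms(4) level_gap'[of "v i" z] by auto
  moreover have "v a \<sim> v (Suc a)" "Suc a \<le> d" "\<not> x \<sim> v (Suc a)"
    using v_step[of a] a d_ge_3 by auto
  ultimately show False
    using no_S122[of x w s s' "v a" "v (Suc a)"] x a(2) neg assms(3) by (simp add: adj_commute)
qed

lemma right_2_dominated:
  assumes "w \<in> right 2" "s \<in> right 2" "s \<sim> s'" "s' \<in> U" "s' \<notin> right 2"
  shows "w \<sim> s \<or> w \<sim> s'"
  using diametral_path.left_2_dominated[OF reverse, unfolded reverse_P diff_zero] assms by blast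

text \<open>\<open>s\<close> is a shortest walk in \<open>U\<close> from one side to the other. It
  exists since \<open>w\<close> is so high that short walks from it to the two ends of
  \<open>P\<close> must leave \<open>U\<close> on different sides.\<close>

lemma outer_connection:
  assumes "w \<in> V" "7 \<le> level w"
  obtains s N where "s 0 \<in> left 2" "s N \<in> right 2" "\<And>i. i < N \<Longrightarrow> (s i, s (Suc i)) \<in> W"
    "\<And>a b t. a \<in> left 2 \<Longrightarrow> b \<in> right 2 \<Longrightarrow> (a, b) \<in> W ^^ t \<Longrightarrow> N \<le> t"
    "4 \<le> N" "N < d" "8 \<le> d"
proof -
  have wU: "w \<in> U" using assms by simp
  \<comment> \<open>A vertex of level at least 7 needs at least five steps to come down to level
    2.\<close>
  have far: "\<exists>t k a. (w, a) \<in> W ^^ t \<and> t + 1 + k \<le> d \<and> 1 \<le> k \<and> 5 \<le> t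
    \<and> (a \<in> left 2 \<and> i \<le> k + 1 \<or> a \<in> right 2 \<and> d \<le> i + k + 1)" if i: "i \<le> d" for i
  proof -
    obtain n where n: "n \<le> d" "(w, v i) \<in> R ^^ n" using short assms(1) v_V[OF i] by blast
    obtain t k a where tk: "(w, a) \<in> W ^^ t" "n = t + 1 + k" "1 \<le> k"
      "a \<in> left 2 \<and> i \<le> k + 1 \<or> a \<in> right 2 \<and> d \<le> i + k + 1"
      using walk_to_path[OF n(2) wU i] by blast
    have a: "level a = 2" "a \<in> V" using tk(4) left_level right_level left_V right_V by blast+
    have "(a, w) \<in> R ^^ t" using relpow_mono[OF W_sub tk(1)] relpow_sym by blast
    then have "5 \<le> t" using level_relpow[of a w t] a assms(2) by simp
    then show ?thesis using tk n(1) by blast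
  qed
  \<comment> \<open>For \<open>i = 3\<close> an exit on the right would make the walk longer than
    \<open>d\<close>; an exit on the left has \<open>k \<ge> 2\<close>, hence
    \<open>5 + 1 + 2 \<le> d\<close>.\<close>
  have d8: "8 \<le> d" using far[of 3] d_ge_3 by auto
  \<comment> \<open>Since \<open>t \<ge> 5\<close>, too few steps remain to travel the length of
    \<open>P\<close>, which fixes the side of the exit.\<close>
  obtain t b where b: "b \<in> right 2" "(w, b) \<in> W ^^ t" using far[of d] by auto
  obtain t' a where a: "a \<in> left 2" "(w, a) \<in> W ^^ t'" using far[of 0] by auto
  define Q where "Q n \<longleftrightarrow> (\<exists>a \<in> left 2. \<exists>b \<in> right 2. (a, b) \<in> W ^^ n)" for n
  have "Q (t' + t)" unfolding Q_def using a b relpow_addI[OF W_sym[OF a(2)] b(2)] by blast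
  then have QN: "Q (LEAST n. Q n)" by (rule LeastI)
  define N where "N = (LEAST n. Q n)"
  obtain a b where ab: "a \<in> left 2" "b \<in> right 2" "(a, b) \<in> W ^^ N"
    using QN unfolding N_def Q_def by blast
  have min: "N \<le> t" if "a \<in> left 2" "b \<in> right 2" "(a, b) \<in> W ^^ t" for a b t
    unfolding N_def by (rule Least_le) (use that Q_def in blast)
  obtain s where s: "s 0 = a" "s N = b" "\<And>i. i < N \<Longrightarrow> (s i, s (Suc i)) \<in> W"
    using ab(3) unfolding relpow_fun_conv by blast
  have "4 \<le> N"
  proof -
    obtain x where x: "x \<in> left 1" "x \<sim> a" using ab(1) left_parent[of a 1] by (auto simp: numeral_2_eq_2)
    obtain x' where x': "v d \<sim> x'" "x' \<sim> b" using ab(2) by (auto simp: numeral_2_eq_2)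
    have "(v 0, a) \<in> R ^^ 2" using x by (auto simp: numeral_2_eq_2)
    moreover have "(b, v d) \<in> R ^^ 2" using x' by (auto simp: numeral_2_eq_2 adj_commute)
    moreover have "(a, b) \<in> R ^^ N" using relpow_mono[OF W_sub ab(3)] .
    ultimately have "(v 0, v d) \<in> R ^^ (2 + N + 2)" by (intro relpow_addI)
    then show ?thesis using v_geodesic d8 by fastforce
  qed
  have "N < d"
  proof -
    \<comment> \<open>The walk to \<open>v d\<close> starts at \<open>s 1\<close>, not at
      \<open>s 0\<close>: a left exit forces \<open>t = 0\<close>, which
      \<open>s 1 \<notin> left 2\<close> excludes. So the exit is on the right and
      \<open>N \<le> Suc t < d\<close>.\<close>
    have s1: "(s 0, s 1) \<in> W" using s(3)[of 0] \<open>4 \<le> N\<close> by simp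
    then obtain n where n: "n \<le> d" "(s 1, v d) \<in> R ^^ n" using short v_V[of d] by blast
    obtain t k a' where tk: "(s 1, a') \<in> W ^^ t" "n = t + 1 + k" "1 \<le> k"
      "a' \<in> left 2 \<and> d \<le> k + 1 \<or> a' \<in> right 2 \<and> d \<le> d + k + 1"
      using walk_to_path[OF n(2)] s1 by blast
    have "(s 1, s N) \<in> W ^^ (N - 1)"
      using s(3) \<open>4 \<le> N\<close> by (intro relpow_path) auto
    then have "s 1 \<notin> left 2" using min[of "s 1" "s N" "N - 1"] ab s \<open>4 \<le> N\<close> by auto
    have "a' \<in> right 2"
    proof (rule ccontr)
      assume "a' \<notin> right 2"
      then have "a' \<in> left 2" "t = 0" using tk n(1) by auto
      then show False using tk(1) \<open>s 1 \<notin> left 2\<close> by simp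
    qed
    moreover have "(s 0, a') \<in> W ^^ Suc t" using s1 tk(1) by (rule relpow_Suc_I2)
    ultimately have "N \<le> Suc t" using min ab(1) s(1) by blast
    then show ?thesis using tk n(1) by simp
  qed
  then show thesis using that[of s N] s ab min \<open>4 \<le> N\<close> d8 by blast
qed

section \<open>The periodic colouring of a dominating cycle\<close>

lemma cyclic_colouring:
  assumes "w \<in> V" "7 \<le> level w"
  shows "\<exists>c. rainbow c \<and> c ` V \<subseteq> {..<d + 3}"
proof -
  obtain s N where s: "s 0 \<in> left 2" "s N \<in> right 2" and sW: "\<And>i. i < N \<Longrightarrow> (s i, s (Suc i)) \<in> W"
    and min: "\<And>a b t. a \<in> left 2 \<Longrightarrow> b \<in> right 2 \<Longrightarrow> (a, b) \<in> W ^^ t \<Longrightarrow> N \<le> t"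
    and N: "4 \<le> N" "N < d" "8 \<le> d"
    using outer_connection[OF assms] by blast
  have two: "z \<in> left 2 \<longleftrightarrow> level z = 2 \<and> (\<exists>y\<in>left 1. y \<sim> z)"
    "z \<in> right 2 \<longleftrightarrow> level z = 2 \<and> (\<exists>y\<in>right 1. y \<sim> z)" for z
    by (simp_all add: numeral_2_eq_2)
  have sU: "s i \<in> U" if "i \<le> N" for i
    using sW[of i] sW[of "i - 1"] that N(1) by (cases "i < N") auto
  have step_s: "s i \<sim> s (Suc i)" if "i < N" for i using sW[OF that] by simp
  have sub: "(s i, s j) \<in> W ^^ (j - i)" if "i \<le> j" "j \<le> N" for i j
    using that by (intro relpow_path sW) auto
  have left_s: "i = 0" if "s i \<in> left 2" "i \<le> N" for i
    using min[OF that(1) s(2) sub[OF that(2) le_refl]] that(2) N(1) by simp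
  have right_s: "i = N" if "s i \<in> right 2" "i \<le> N" for i
    using min[OF s(1) that(1) sub[OF _ that(2)]] that(2) by simp
  \<comment> \<open>Level drops by at most one along an edge, so a neighbour in \<open>U\<close> of
    a vertex of \<open>left 1\<close> has level exactly 2.\<close>
  have door: "z \<in> left 2" if "x \<in> left 1" "x \<sim> z" "z \<in> U" for x z
    using that level_adj[of x z] unfolding two by auto
  have door': "z \<in> right 2" if "x \<in> right 1" "x \<sim> z" "z \<in> U" for x z
    using that level_adj[of x z] right_level[OF that(1)] unfolding two by auto
  obtain x where x: "x \<in> left 1" "x \<sim> s 0" using s(1) two by blast
  obtain x' where x': "x' \<in> right 1" "x' \<sim> s N" using s(2) two by blast
  obtain a where a: "a \<le> 2" "x \<sim> v a" "\<And>i. a < i \<Longrightarrow> i \<le> d \<Longrightarrow> \<not> x \<sim> v i"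
    using left_last_neighbour[OF x(1)] by blast
  obtain b where b: "b \<le> d" "d \<le> b + 2" "x' \<sim> v b" "\<And>i. i < b \<Longrightarrow> \<not> x' \<sim> v i"
  proof -
    obtain b' where b': "b' \<le> 2" "x' \<sim> v (d - b')"
      "\<And>i. b' < i \<Longrightarrow> i \<le> d \<Longrightarrow> \<not> x' \<sim> v (d - i)"
      using diametral_path.left_last_neighbour[OF reverse, unfolded reverse_P diff_zero] x'(1) by blast
    have "\<not> x' \<sim> v i" if "i < d - b'" for i
      using that b'(3)[of "d - i"] by simp
    then show thesis using that[of "d - b'"] b' by auto
  qed
  have lx: "level x = 1" "level x' = 1" using left_level[OF x(1)] right_level[OF x'(1)] by simp_all
  have ends: "x \<sim> v 0" "x' \<sim> v d" using x(1) x'(1) by (auto simp: adj_commute)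
  txt \<open>The two vertices of \<open>P\<close> beyond \<open>x\<close> and beyond \<open>x'\<close> make \<open>e\<close> an induced path on which every
    neighbour of a vertex of \<open>U\<close> is at least two steps away from the ends.\<close>
  define e where "e i = (if i = 0 then v (Suc a) else if i = 1 then v a else if i = 2 then x
    else if i < N + 4 then s (i - 3) else if i = N + 4 then x'
    else if i = N + 5 then v b else v (b - 1))" for i
  have far: "\<not> x \<sim> v i" if "3 \<le> i" "i \<le> d" for i
    using v_common[OF ends(1), of i] that by auto
  have far': "\<not> x' \<sim> v i" if "i + 3 \<le> d" for i
    using v_common[OF _ ends(2), of i] that by auto
  have xx: "\<not> x \<sim> x'"
  proof
    assume "x \<sim> x'"
    moreover have "v 0 \<sim> x" using ends(1) adj_commute by blast
    ultimately have "(v 0, v d) \<in> R ^^ 3"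
      using ends(2) by (auto simp: numeral_3_eq_3)
    then show False using v_geodesic[of 3] N(3) by simp
  qed
  have step_e: "e i \<sim> e (Suc i)" if i: "i < N + 6" for i
  proof -
    consider "i = 0" | "i = 1" | "i = 2" | "3 \<le> i" "i < N + 3" | "i = N + 3" | "i = N + 4" | "i = N + 5"
      using i by linarith
    then show ?thesis
    proof cases
      case 4
      then have "e i = s (i - 3)" "e (Suc i) = s (Suc i - 3)" by (simp_all add: e_def)
      moreover have "Suc i - 3 = Suc (i - 3)" using 4 by (simp only: Suc_diff_le)
      ultimately show ?thesis using step_s[of "i - 3"] 4 by simp
    qed (use a b x x' N v_adj in \<open>auto simp: e_def adj_commute\<close>)
  qed
  have sv: "\<not> s i \<sim> v j" "\<not> v j \<sim> s i" if "i \<le> N" "j \<le> d" for i j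
    using sU[OF that(1)] that(2) level_gap[of "v j" "s i"] level_gap'[of "v j" "s i"] by auto
  have xs: "\<not> x \<sim> s i" if "0 < i" "i \<le> N" for i
    using door[OF x(1), of "s i"] left_s[of i] sU[of i] that by auto
  have sx': "\<not> s i \<sim> x'" if "i < N" for i
    using door'[OF x'(1), of "s i"] right_s[of i] sU[of i] that by (auto simp: adj_commute)
  have ss: "\<not> s i \<sim> s j" if "i + 2 \<le> j" "j \<le> N" for i j
  proof
    assume "s i \<sim> s j"
    then have "(s i, s j) \<in> W ^^ 1" using sU that by auto
    then have "(s 0, s N) \<in> W ^^ (i - 0 + 1 + (N - j))"
      using sub[of 0 i] sub[of j N] that by (intro relpow_addI) auto
    then show False using min[OF s] that by fastforce
  qed
  have e_x: "e 2 = x" "e (N + 4) = x'" by (simp_all add: e_def)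
  have e_s: "e i = s (i - 3)" if "3 \<le> i" "i < N + 4" for i using that by (simp add: e_def)
  \<comment> \<open>The ends of \<open>e\<close> have indices at most 3 and at least
    \<open>d - 3\<close> on \<open>P\<close>; since \<open>d \<ge> 8\<close>, no edge joins
    them.\<close>
  have e_first: "\<exists>k\<le>3. e i = v k" if "i \<le> 1" for i
    using that a(1) by (intro exI[of _ "if i = 0 then Suc a else a"]) (auto simp: e_def)
  have e_last: "\<exists>l\<le>d. d \<le> l + 3 \<and> e i = v l" if "N + 5 \<le> i" "i \<le> N + 6" for i
    using that b(1,2) by (intro exI[of _ "if i = N + 5 then b else b - 1"]) (auto simp: e_def)
  have chordless: "\<not> e i \<sim> e j" if ij: "i + 2 \<le> j" "j \<le> N + 6" for i j
  proof -
    have j: "j = 2 \<or> 3 \<le> j \<and> j < N + 4 \<or> j = N + 4 \<or> N + 5 \<le> j" using ij by linarith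
    consider "i \<le> 1" | "i = 2" | "3 \<le> i" "i < N + 4" | "i = N + 4" using ij by linarith
    then show ?thesis
    proof cases
      case 1
      then obtain k where k: "k \<le> 3" "e i = v k" using e_first by blast
      from j show ?thesis
      proof (elim disjE conjE)
        assume "j = 2"
        then show ?thesis using ij a N(3) by (simp add: e_def adj_commute)
      next
        assume "3 \<le> j" "j < N + 4"
        then show ?thesis using k e_s[of j] sv(2)[of "j - 3" k] N(3) by simp
      next
        assume "j = N + 4"
        then show ?thesis using k far'[of k] N(3) by (simp add: e_x adj_commute)
      next
        assume "N + 5 \<le> j"
        then obtain l where "l \<le> d" "d \<le> l + 3" "e j = v l" using e_last ij(2) by blast
        then show ?thesis using k v_adj[of k l] N(3) by simp
      qed
    next
      case 2
      from j show ?thesis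
      proof (elim disjE conjE)
        assume "3 \<le> j" "j < N + 4"
        then show ?thesis using 2 ij(1) e_s[of j] xs[of "j - 3"] by (simp add: e_x)
      next
        assume "j = N + 4"
        then show ?thesis using 2 xx by (simp add: e_x)
      next
        assume "N + 5 \<le> j"
        then obtain l where "l \<le> d" "d \<le> l + 3" "e j = v l" using e_last ij(2) by blast
        then show ?thesis using 2 far[of l] N(3) by (simp add: e_x)
      qed (use 2 ij in simp)
    next
      case 3
      from j show ?thesis
      proof (elim disjE conjE)
        assume "3 \<le> j" "j < N + 4"
        then show ?thesis using 3 e_s[of i] e_s[of j] ss[of "i - 3" "j - 3"] ij by simp
      next
        assume "j = N + 4"
        then show ?thesis using 3 ij(1) e_s[of i] sx'[of "i - 3"] by (simp add: e_x)
      next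
        assume "N + 5 \<le> j"
        then obtain l where "l \<le> d" "e j = v l" using e_last ij(2) by blast
        then show ?thesis using 3 e_s[of i] sv(1)[of "i - 3" l] by simp
      qed (use 3 ij in simp)
    next
      case 4
      have "e (N + 6) = v (b - 1)" by (simp add: e_def)
      moreover have "j = N + 6" using 4 ij by simp
      ultimately show ?thesis using 4 b(2) b(4)[of "b - 1"] N(3) by (simp add: e_x)
    qed
  qed
  \<comment> \<open>The first two and last two vertices of \<open>e\<close> lie on \<open>P\<close>,
    out of reach from \<open>U\<close>.\<close>
  have inner: "2 \<le> i \<and> i + 2 \<le> N + 6" if "i \<le> N + 6" "y \<in> U" "y \<sim> e i" for i y
  proof -
    have yv: "\<not> y \<sim> v j" if "j \<le> d" for j using that \<open>y \<in> U\<close> level_gap'[of "v j" y] by auto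
    show ?thesis using that yv e_first[of i] e_last[of i] N(3) by fastforce
  qed
  \<comment> \<open>For \<open>i = 2\<close> the neighbour is \<open>x\<close>, so \<open>y\<close>
    itself is in \<open>left 2\<close> and the walk is empty; otherwise it runs from
    \<open>s 0\<close> to \<open>s (i - 3)\<close> and on to \<open>y\<close>.\<close>
  have from_left: "\<exists>z \<in> left 2. (z, y) \<in> W ^^ (i - 2)" if "y \<in> U" "y \<sim> e i" "2 \<le> i" "i < N + 4" for i y
  proof (cases "i = 2")
    case True
    then show ?thesis using that door[OF x(1), of y] by (auto simp: e_def adj_commute)
  next
    case False
    then have "s (i - 3) \<sim> y" using that by (simp add: e_def adj_commute)
    then have "(s 0, y) \<in> W ^^ Suc (i - 3 - 0)"
      using that sU[of "i - 3"] sub[of 0 "i - 3"] by (intro relpow_Suc_I) auto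
    moreover have "Suc (i - 3 - 0) = i - 2" using False that by simp
    ultimately have "(s 0, y) \<in> W ^^ (i - 2)" by (simp only:)
    then show ?thesis using s(1) by (rule bexI)
  qed
  have to_right: "\<exists>z \<in> right 2. (y, z) \<in> W ^^ (N + 4 - i)" if "y \<in> U" "y \<sim> e i" "3 \<le> i" "i \<le> N + 4" for i y
  proof (cases "i = N + 4")
    case True
    then show ?thesis using that door'[OF x'(1), of y] by (auto simp: e_def adj_commute)
  next
    case False
    then have "y \<sim> s (i - 3)" using that by (simp add: e_def)
    then have "(y, s N) \<in> W ^^ Suc (N - (i - 3))"
      using that False sU[of "i - 3"] sub[of "i - 3" N] by (intro relpow_Suc_I2[of y "s (i - 3)"]) auto
    moreover have "Suc (N - (i - 3)) = N + 4 - i" using False that by simp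
    ultimately have "(y, s N) \<in> W ^^ (N + 4 - i)" by (simp only:)
    then show ?thesis using s(2) by (rule bexI)
  qed
  \<comment> \<open>Neighbours more than two apart would allow a shortcut through \<open>y\<close>
    from left to right, shorter than \<open>N\<close>.\<close>
  have narrow: "j \<le> i + 2" if y: "y \<in> U" "i \<le> N + 6" "j \<le> N + 6" "y \<sim> e i" "y \<sim> e j" for i j y
  proof (rule ccontr)
    assume "\<not> j \<le> i + 2"
    moreover have "2 \<le> i" "j \<le> N + 4" using inner[OF y(2,1,4)] inner[OF y(3,1,5)] by auto
    ultimately have "2 \<le> i" "i < N + 4" "3 \<le> j" "j \<le> N + 4" by linarith+
    then obtain z z' where zz: "z \<in> left 2" "(z, y) \<in> W ^^ (i - 2)" "z' \<in> right 2" "(y, z') \<in> W ^^ (N + 4 - j)"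
      using from_left[OF y(1,4)] to_right[OF y(1,5)] by blast
    have "N \<le> i - 2 + (N + 4 - j)" using min[OF zz(1,3) relpow_addI[OF zz(2,4)]] .
    then show False using \<open>\<not> j \<le> i + 2\<close> \<open>2 \<le> i\<close> \<open>j \<le> N + 4\<close> by simp
  qed
  \<comment> \<open>Level 2 is dominated by the first or last edge of \<open>s\<close>; higher
    levels inherit domination from a parent via \<open>induced_path_dominates\<close>.\<close>
  have dominated: "\<exists>i\<le>N + 6. y \<sim> e i" if "y \<in> V" "level y = k + 2" for y k
    using that
  proof (induction k arbitrary: y)
    case 0
    have e3: "e 3 = s 0" "e 4 = s 1" using N by (simp_all add: e_def)
    have eN: "e (N + 3) = s N" "e (N + 2) = s (N - 1)" using N by (auto simp: e_def)
    have "y \<in> left 2 \<union> right 2" using side[OF 0(1,2)] by (simp only: add_0)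
    then show ?case
    proof
      assume "y \<in> left 2"
      then have "y \<sim> e 3 \<or> y \<sim> e 4"
        unfolding e3 using step_s[of 0] sU[of 1] left_s[of 1] N(1)
        by (intro left_2_dominated[OF _ s(1)]) auto
      moreover have "3 \<le> N + 6" "4 \<le> N + 6" by simp_all
      ultimately show ?thesis by blast
    next
      assume "y \<in> right 2"
      then have "y \<sim> e (N + 3) \<or> y \<sim> e (N + 2)"
        unfolding eN using step_s[of "N - 1"] sU[of "N - 1"] right_s[of "N - 1"] N(1)
        by (intro right_2_dominated[OF _ s(2)]) (auto simp: adj_commute)
      moreover have "N + 3 \<le> N + 6" "N + 2 \<le> N + 6" by simp_all
      ultimately show ?thesis by blast
    qed
  next
    case (Suc k)
    obtain z where z: "z \<sim> y" "level z = k + 2"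
      using level_parent[OF Suc.prems(1), of "k + 2"] Suc.prems(2) by auto
    then have zU: "z \<in> U" using adj_V by auto
    obtain j where j: "j \<le> N + 6" "z \<sim> e j" using Suc.IH[OF _ z(2)] zU by auto
    show ?case
      by (rule induced_path_dominates[of "N + 6" e z y j])
        (use step_e chordless inner[OF _ zU] narrow[OF zU] z j in \<open>auto simp: adj_commute\<close>)
  qed
  \<comment> \<open>The cycle is \<open>v 0\<close> to \<open>v d\<close>, then \<open>x'\<close>,
    \<open>s N\<close> down to \<open>s 0\<close>, and \<open>x\<close>: these are
    \<open>(d + 1) + (N + 3)\<close> vertices. Index \<open>d + 1\<close> is
    \<open>e (N + 4)\<close> and index \<open>n - 1\<close> is \<open>e 2\<close>.\<close>
  define n where "n = d + N + 4"
  define g where "g i = (if i \<le> d then v i else e (n + 1 - i))" for i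
  \<comment> \<open>A repeated vertex would produce a loop or a chord; the bound
    \<open>N + 4\<close> leaves room for the index \<open>Suc j\<close>.\<close>
  have e_inj: "e i \<noteq> e j" if ij: "i < j" "j \<le> N + 4" for i j
  proof
    assume eq: "e i = e j"
    consider "j = i + 1" | "j = i + 2" | "i + 3 \<le> j" using ij by linarith
    then show False
    proof cases
      case 1
      then show ?thesis using step_e[of i] eq that R_irrefl by auto
    next
      case 2
      then show ?thesis using step_e[of j] chordless[of i "Suc j"] eq that by auto
    next
      case 3
      then show ?thesis using step_e[of i] chordless[of "Suc i" j] eq that by (auto simp: adj_commute)
    qed
  qed
  have e_level: "0 < level (e i)" if "2 \<le> i" "i \<le> N + 4" for i
  proof (cases "i = 2 \<or> i = N + 4")
    case True
    then show ?thesis using lx by (auto simp: e_x)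
  next
    case False
    then have "3 \<le> i" "i < N + 4" "i - 3 \<le> N" using that by auto
    then show ?thesis using e_s[of i] sU[of "i - 3"] by simp
  qed
  show ?thesis
  proof (rule dominating_cycle_colouring[of g n])
    show "inj_on g {..<n}"
    proof (rule linorder_inj_onI)
      fix i j assume ij: "i < j" "i \<in> {..<n}" "j \<in> {..<n}"
      have idx: "2 \<le> n + 1 - k \<and> n + 1 - k \<le> N + 4" if "d < k" "k < n" for k
        using that unfolding n_def by auto
      consider "j \<le> d" | "i \<le> d" "d < j" | "d < i" using ij by linarith
      then show "g i \<noteq> g j"
      proof cases
        case 1
        then show ?thesis using ij v_inj by (simp add: g_def)
      next
        case 2
        then have "level (g i) = 0" "0 < level (g j)"
          using e_level[of "n + 1 - j"] idx[of j] ij by (simp_all add: g_def)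
        then show ?thesis by auto
      next
        case 3
        then have "n + 1 - j < n + 1 - i" "g i = e (n + 1 - i)" "g j = e (n + 1 - j)"
          using ij by (auto simp: g_def)
        then show ?thesis using e_inj[of "n + 1 - j" "n + 1 - i"] idx[of i] 3 ij by simp
      qed
    qed auto
    show "g i \<sim> g (Suc i)" if "Suc i < n" for i
    proof -
      consider "i < d" | "i = d" | "d < i" by linarith
      then show ?thesis
      proof cases
        case 1
        then show ?thesis using v_step by (simp add: g_def)
      next
        case 2
        have "n + 1 - Suc d = N + 4" by (simp add: n_def)
        then have "g (Suc d) = x'" "g d = v d" using e_x by (simp_all only: g_def) simp_all
        then show ?thesis using 2 ends(2) adj_commute by simp
      next
        case 3
        have idx: "n + 1 - i = Suc (n - i)" "n + 1 - Suc i = n - i" "n - i < N + 6"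
          using 3 that by (auto simp: n_def)
        have "g i = e (Suc (n - i))" "g (Suc i) = e (n - i)"
          using 3 by (simp_all only: g_def idx) simp_all
        then show ?thesis using step_e[OF idx(3)] adj_commute by simp
      qed
    qed
    show "g (n - 1) \<sim> g 0" using ends(1) N by (simp add: g_def n_def e_def)
    \<comment> \<open>By \<open>N < d\<close> the length \<open>n\<close> is at most
      \<open>2 * d + 3\<close>.\<close>
    show "n \<le> 2 * (d + 3)" using N by (simp add: n_def)
    show "0 < d + 3" by simp
    fix u assume u: "u \<in> V"
    show "(\<exists>i<n. i < d + 3 \<and> u \<sim> g i) \<or> (\<exists>i j. i < j \<and> j < n \<and> u \<sim> g i \<and> u \<sim> g j)"
    proof (cases "level u \<le> 1")
      case True
      have "\<exists>i\<le>d. u \<sim> v i"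
      proof (cases "level u = 0")
        case True
        then obtain i where "i \<le> d" "u = v i" using level_0[OF u] by auto
        \<comment> \<open>A vertex of \<open>P\<close> is not its own neighbour; its successor is
          taken, or the predecessor for \<open>v d\<close>.\<close>
        then show ?thesis using v_adj[of i "if i = d then i - 1 else Suc i"] d_ge_3
          by (intro exI[of _ "if i = d then i - 1 else Suc i"]) auto
      next
        case False
        then show ?thesis using level_1[OF u] \<open>level u \<le> 1\<close> by auto
      qed
      then obtain i where "i \<le> d" "u \<sim> v i" by blast
      then show ?thesis by (intro disjI1 exI[of _ i]) (auto simp: n_def g_def)
    next
      case False
      then have uU: "u \<in> U" using u by simp
      have "level u = level u - 2 + 2" using False by linarith
      then obtain i where i: "i \<le> N + 6" "u \<sim> e i"
        using dominated[OF u] by blast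
      have i2: "2 \<le> i" "i + 2 \<le> N + 6" using inner[OF i(1) uU i(2)] by auto
      obtain j where j: "j \<le> N + 6" "j \<noteq> i" "u \<sim> e j"
        \<comment> \<open>The two extra vertices at each end of \<open>e\<close> make the lemma
          applicable even at \<open>x\<close> and \<open>x'\<close>; by \<open>inner\<close> the
          second neighbour is again on the cycle.\<close>
        using induced_path_second_neighbour[of "N + 6" e u i] step_e chordless i i2 by blast
      have j2: "2 \<le> j" "j + 2 \<le> N + 6" using inner[OF j(1) uU j(3)] by auto
      have "g (n + 1 - k) = e k" if "2 \<le> k" "k + 2 \<le> N + 6" for k
      proof -
        have "n + 1 - (n + 1 - k) = k" "d < n + 1 - k" using that by (auto simp: n_def)
        then show ?thesis by (simp only: g_def) simp
      qed
      then have "u \<sim> g (n + 1 - i)" "u \<sim> g (n + 1 - j)" using i i2 j j2 by simp_all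
      moreover have "n + 1 - i < n" "n + 1 - j < n" "n + 1 - i \<noteq> n + 1 - j"
        using i2 j2 j(2) by (auto simp: n_def)
      ultimately show ?thesis by (metis nat_neq_iff)
    qed
  qed
qed

end

section \<open>Transfer to pair graphs\<close>

lemma (in pair_wf_digraph) restricted_walk_awalk:
  assumes "(u, w) \<in> (Restr (parcs G) A)\<^sup>*" "u \<in> pverts G" "u \<in> A"
  shows "\<exists>p. awalk u p w \<and> set p \<subseteq> Restr (parcs G) A"
  using assms(1)
proof (induction rule: rtrancl_induct)
  case base
  then show ?case using assms by (intro exI[of _ "[]"]) (simp add: awalk_Nil_iff)
next
  case (step y z)
  then obtain p where p: "awalk u p y" "set p \<subseteq> Restr (parcs G) A" by blast
  have "awalk y [(y, z)] z"
    using step(2) by (auto simp: awalk_def dest: wellformed')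
  with p step(2) show ?case
    by (intro exI[of _ "p @ [(y, z)]"]) (auto intro: awalk_appendI)
qed

text \<open>Shortening a walk to a path only drops arcs, so the inner vertices stay in
  \<open>A\<close> and avoid the ends.\<close>

lemma (in pair_wf_digraph) vertex_rainbow_pathI:
  assumes "(u, w) \<in> (Restr (parcs G) A)\<^sup>*" "u \<in> pverts G" "u \<noteq> w"
    and inj: "inj_on c (A - {u, w})"
  shows "\<exists>p. vertex_rainbow_path (with_proj G) c u p w"
proof -
  from assms(1) have "u \<in> A"
    by (cases rule: converse_rtranclE) (use assms(3) in auto)
  then obtain p where p: "awalk u p w" "set p \<subseteq> Restr (parcs G) A"
    using restricted_walk_awalk[OF assms(1,2)] by blast
  define q where "q = awalk_to_apath p"
  have q: "apath u q w" "set q \<subseteq> Restr (parcs G) A"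
    unfolding q_def using apath_awalk_to_apath[OF p(1)] awalk_to_apath_subset[OF p(1)] p(2) by auto
  then have ne: "q \<noteq> []" using assms(3) by (auto simp: apath_Nil_iff)
  have "set (pawalk_verts u q) \<subseteq> A"
    using q(2) ne awalk_verts_conv[of u q] by (auto dest: last_in_set)
  then have "set (inner_verts q) \<subseteq> A - {u, w}"
    using set_inner_verts[OF q(1)] by auto
  then show ?thesis
    using q(1) inj_on_subset[OF inj] unfolding vertex_rainbow_path_def by auto
qed

lemma rvc_le_card_colours:
  assumes "pair_wf_digraph G"
    and "\<And>u w. u \<in> pverts G \<Longrightarrow> w \<in> pverts G \<Longrightarrow> u \<noteq> w \<Longrightarrow>
      \<exists>A. (u, w) \<in> (Restr (parcs G) A)\<^sup>* \<and> inj_on c (A - {u, w})"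
  shows "rvc (with_proj G) \<le> card ((c :: 'a \<Rightarrow> nat) ` pverts G)"
proof -
  interpret pair_wf_digraph G by fact
  have "rainbow_vertex_connected (with_proj G) c"
    unfolding rainbow_vertex_connected_def using vertex_rainbow_pathI assms(2)
    by (metis with_proj_simps(1))
  then show ?thesis
    unfolding rvc_def by (auto intro: Least_le)
qed

lemma (in pair_wf_digraph) awalk_relpow:
  "awalk u p w \<Longrightarrow> (u, w) \<in> parcs G ^^ length p"
proof (induction p arbitrary: u)
  case (Cons e p)
  then have "(u, snd e) \<in> parcs G" "(snd e, w) \<in> parcs G ^^ length p"
    by (auto simp: awalk_Cons_iff)
  then show ?case by (simp only: length_Cons) (rule relpow_Suc_I2)
qed (auto simp: awalk_Nil_iff)

text \<open>Under unit weights the cost of a walk is its length, so a lower bound on all walks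
  between two vertices bounds their distance, and with it the supremum, from below.\<close>

lemma diam_ge:
  assumes "pair_wf_digraph G" "u \<in> pverts G" "w \<in> pverts G"
    and "\<And>n. (u, w) \<in> parcs G ^^ n \<Longrightarrow> d \<le> n"
  shows "ereal (real d) \<le> diam (with_proj G)"
proof -
  interpret pair_wf_digraph G by fact
  have cost: "awalk_cost (\<lambda>_. 1) p = real (length p)" for p :: "('a \<times> 'a) list"
    by (induction p) auto
  have "ereal (real d) \<le> \<mu> (\<lambda>_. 1) u w"
    unfolding \<mu>_def using assms(4) awalk_relpow by (auto intro!: INF_greatest simp: cost)
  also have "\<dots> \<le> (SUP w \<in> pverts G. \<mu> (\<lambda>_. 1) u w)"
    using assms(3) by (rule SUP_upper)
  also have "\<dots> \<le> (SUP u \<in> pverts G. SUP w \<in> pverts G. \<mu> (\<lambda>_. 1) u w)"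
    using assms(2) by (rule SUP_upper)
  finally show ?thesis unfolding diam_def by simp
qed

section \<open>From forbidden induced subgraphs to edge patterns\<close>

text \<open>The inverse of the embedding \<open>f\<close>, applied componentwise to arcs, is an
  isomorphism from the subgraph induced on the image onto \<open>F\<close>.\<close>

lemma induced_freeD:
  fixes F :: "'b pair_pre_digraph" and G :: "'a pair_pre_digraph"
  assumes "pair_wf_digraph F" "pair_wf_digraph G" "induced_free (with_proj F) (with_proj G)"
    and "inj_on f (pverts F)" "f ` pverts F \<subseteq> pverts G"
    and iff: "\<And>i j. i \<in> pverts F \<Longrightarrow> j \<in> pverts F \<Longrightarrow> (i, j) \<in> parcs F \<longleftrightarrow> (f i, f j) \<in> parcs G"
  shows False
proof -
  interpret F: pair_wf_digraph F by fact
  interpret G: pair_wf_digraph G by fact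
  define g where "g = the_inv_into (pverts F) f"
  have gf: "g (f i) = i" if "i \<in> pverts F" for i
    unfolding g_def using assms(4) that by (rule the_inv_into_f_f)
  define H where "H = with_proj G \<restriction> (f ` pverts F)"
  define h where "h = \<lparr> iso_verts = g, iso_arcs = map_prod g g,
    iso_head = (snd :: 'b \<times> 'b \<Rightarrow> 'b), iso_tail = fst \<rparr>"
  have H: "induced_subgraph H (with_proj G)"
    unfolding H_def using assms(5) by (intro G.induced_induce) simp
  have "inj_on g (f ` pverts F)"
    by (rule inj_onI) (auto simp: gf)
  then have "pre_digraph.digraph_isomorphism H h"
    using H unfolding pre_digraph.digraph_isomorphism_def H_def h_def
    by (auto simp: induced_subgraph_def subgraph_def inj_on_def)
  moreover have "with_proj F = app_iso h H"
  proof -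
    have "verts (app_iso h H) = pverts F"
      by (auto simp: h_def H_def gf image_iff)
    moreover have "arcs (app_iso h H) = parcs F"
    proof (intro equalityI subsetI)
      fix e assume "e \<in> arcs (app_iso h H)"
      then show "e \<in> parcs F" by (auto simp: h_def H_def gf iff)
    next
      fix e assume e: "e \<in> parcs F"
      obtain i j where "e = (i, j)" by force
      with e have "i \<in> pverts F" "j \<in> pverts F" "(f i, f j) \<in> parcs G"
        using iff F.wellformed' by blast+
      then show "e \<in> arcs (app_iso h H)" unfolding \<open>e = (i, j)\<close>
        by (auto simp: h_def H_def gf intro!: rev_image_eqI[of "(f i, f j)"])
    qed
    ultimately show ?thesis unfolding with_proj_def by (auto simp: app_iso_def h_def)
  qed
  ultimately have "digraph_iso H (with_proj F)" unfolding digraph_iso_def by blast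
  with H assms(3) show False unfolding induced_free_def by blast
qed

lemma S122_free_cases:
  assumes "pair_graph G" "induced_free (with_proj S122) (with_proj G)"
    and e: "(c, a) \<in> parcs G" "(c, b) \<in> parcs G" "(b, b') \<in> parcs G" "(c, e) \<in> parcs G" "(e, e') \<in> parcs G"
    and n: "(a, b) \<notin> parcs G" "(a, b') \<notin> parcs G" "(a, e) \<notin> parcs G" "(a, e') \<notin> parcs G"
      "(c, b') \<notin> parcs G" "(c, e') \<notin> parcs G" "(b, e) \<notin> parcs G" "(b, e') \<notin> parcs G"
      "(b', e) \<notin> parcs G" "(b', e') \<notin> parcs G"
  shows False
proof -
  interpret pair_graph G by fact
  interpret S: pair_graph S122 by (rule pair_graph_S122)
  have sym: "(x, y) \<in> parcs G \<longleftrightarrow> (y, x) \<in> parcs G" for x y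
    using pair_sym_arcs by (auto simp: symmetric_def sym_def)
  have irr: "(x, x) \<notin> parcs G" for x using pair_no_loops by fastforce
  have n': "(b, a) \<notin> parcs G" "(b', a) \<notin> parcs G" "(e, a) \<notin> parcs G" "(e', a) \<notin> parcs G"
      "(b', c) \<notin> parcs G" "(e', c) \<notin> parcs G" "(e, b) \<notin> parcs G" "(e', b) \<notin> parcs G"
      "(e, b') \<notin> parcs G" "(e', b') \<notin> parcs G" using n sym by blast+
  have e2: "(a, c) \<in> parcs G" "(b, c) \<in> parcs G" "(b', b) \<in> parcs G" "(e, c) \<in> parcs G" "(e', e) \<in> parcs G"
    using e sym by blast+
  \<comment> \<open>Any two of the six vertices are adjacent or told apart by a third vertex
    adjacent to just one of them.\<close>
  have dist: "distinct [c, a, b, b', e, e']"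
    unfolding distinct.simps list.set insert_iff empty_iff simp_thms de_Morgan_disj
    by (intro conjI; use e n n' irr in metis)
  define f where "f = (\<lambda>i::nat. [c, a, b, b', e, e'] ! i)"
  have f: "f 0 = c" "f 1 = a" "f 2 = b" "f 3 = b'" "f 4 = e" "f 5 = e'"
    by (simp_all add: f_def)
  have f': "f (Suc 0) = a" using f by simp
  have P: "pverts S122 = {0, 1, 2, 3, 4, 5}" by (simp add: S122_def)
  have E: "parcs S122 = {(0, 1), (0, 2), (2, 3), (0, 4), (4, 5),
      (1, 0), (2, 0), (3, 2), (4, 0), (5, 4)}"
    by (auto simp: S122_def symcl_def)
  show False
  proof (rule induced_freeD[OF S.pair_wf_digraph_axioms pair_wf_digraph_axioms assms(2)])
    show "inj_on f (pverts S122)" unfolding P f_def using dist by (intro inj_on_nth) auto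
    show "f ` pverts S122 \<subseteq> pverts G" using e unfolding P by (auto simp: f f' dest: wellformed')
    show "(i, j) \<in> parcs S122 \<longleftrightarrow> (f i, f j) \<in> parcs G" if "i \<in> pverts S122" "j \<in> pverts S122" for i j
      using that unfolding P E by (elim insertE emptyE) (simp_all add: f f' e n n' e2 irr)
  qed
qed

lemma net_free_cases:
  assumes "pair_graph G" "induced_free (with_proj net) (with_proj G)"
    and e: "(a, b) \<in> parcs G" "(b, c) \<in> parcs G" "(a, c) \<in> parcs G"
      "(a, a') \<in> parcs G" "(b, b') \<in> parcs G" "(c, c') \<in> parcs G"
    and n: "(a, b') \<notin> parcs G" "(a, c') \<notin> parcs G" "(b, a') \<notin> parcs G" "(b, c') \<notin> parcs G"
      "(c, a') \<notin> parcs G" "(c, b') \<notin> parcs G" "(a', b') \<notin> parcs G" "(a', c') \<notin> parcs G" "(b', c') \<notin> parcs G"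
  shows False
proof -
  interpret pair_graph G by fact
  interpret S: pair_graph net by (rule pair_graph_net)
  have sym: "(x, y) \<in> parcs G \<longleftrightarrow> (y, x) \<in> parcs G" for x y
    using pair_sym_arcs by (auto simp: symmetric_def sym_def)
  have irr: "(x, x) \<notin> parcs G" for x using pair_no_loops by fastforce
  have n': "(b', a) \<notin> parcs G" "(c', a) \<notin> parcs G" "(a', b) \<notin> parcs G" "(c', b) \<notin> parcs G"
      "(a', c) \<notin> parcs G" "(b', c) \<notin> parcs G" "(b', a') \<notin> parcs G" "(c', a') \<notin> parcs G" "(c', b') \<notin> parcs G"
    using n sym by blast+
  have e2: "(b, a) \<in> parcs G" "(c, b) \<in> parcs G" "(c, a) \<in> parcs G"
      "(a', a) \<in> parcs G" "(b', b) \<in> parcs G" "(c', c) \<in> parcs G"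
    using e sym by blast+
  have dist: "distinct [a, b, c, a', b', c']"
    unfolding distinct.simps list.set insert_iff empty_iff simp_thms de_Morgan_disj
    by (intro conjI; use e n n' irr in metis)
  define f where "f = (\<lambda>i::nat. [a, b, c, a', b', c'] ! i)"
  have f: "f 0 = a" "f 1 = b" "f 2 = c" "f 3 = a'" "f 4 = b'" "f 5 = c'"
    by (simp_all add: f_def)
  have f': "f (Suc 0) = b" using f by simp
  have P: "pverts net = {0, 1, 2, 3, 4, 5}" by (simp add: net_def)
  have E: "parcs net = {(0, 1), (1, 2), (0, 2), (0, 3), (1, 4), (2, 5),
      (1, 0), (2, 1), (2, 0), (3, 0), (4, 1), (5, 2)}"
    by (auto simp: net_def symcl_def)
  show False
  proof (rule induced_freeD[OF S.pair_wf_digraph_axioms pair_wf_digraph_axioms assms(2)])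
    show "inj_on f (pverts net)" unfolding P f_def using dist by (intro inj_on_nth) auto
    show "f ` pverts net \<subseteq> pverts G" using e unfolding P by (auto simp: f f' dest: wellformed')
    show "(i, j) \<in> parcs net \<longleftrightarrow> (f i, f j) \<in> parcs G" if "i \<in> pverts net" "j \<in> pverts net" for i j
      using that unfolding P E by (elim insertE emptyE) (simp_all add: f f' e n n' e2 irr)
  qed
qed

lemma S122_net_free_graphI:
  assumes "pair_graph G"
    and "induced_free (with_proj S122) (with_proj G)" "induced_free (with_proj net) (with_proj G)"
  shows "S122_net_free_graph (pverts G) (parcs G)"
proof -
  interpret pair_graph G by fact
  show ?thesis
  proof
    show "parcs G \<subseteq> pverts G \<times> pverts G" by (auto dest: wellformed')
    show "sym (parcs G)" using pair_sym_arcs by (simp add: symmetric_def)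
    show "(x, x) \<notin> parcs G" for x using pair_no_loops by fastforce
  qed (fact S122_free_cases[OF assms(1,2)] net_free_cases[OF assms(1,3)])+
qed

section \<open>Diametral pairs and the final bound\<close>

lemma connected_relpow:
  assumes "pair_graph G" "connected (with_proj G)" "u \<in> pverts G" "w \<in> pverts G"
  shows "\<exists>n. (u, w) \<in> parcs G ^^ n"
proof -
  interpret pair_graph G by fact
  have "strongly_connected (with_proj G)"
    using symmetric_connected_imp_strongly_connected[OF pair_sym_arcs assms(2)] .
  then have "u \<rightarrow>\<^sup>*\<^bsub>with_proj G\<^esub> w"
    using assms(3,4) by (auto simp: strongly_connected_def)
  then have "(u, w) \<in> (parcs G)\<^sup>*"
    using reachable_rtranclI[of "with_proj G" u w] by simp
  then show ?thesis by (simp add: rtrancl_power)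
qed

lemma exists_diametral_pair:
  fixes r :: "'a rel"
  assumes "finite V" "V \<noteq> {}" "\<And>x y. x \<in> V \<Longrightarrow> y \<in> V \<Longrightarrow> \<exists>n. (x, y) \<in> r ^^ n"
  obtains a b d where "a \<in> V" "b \<in> V" "(a, b) \<in> r ^^ d" "\<And>n. (a, b) \<in> r ^^ n \<Longrightarrow> d \<le> n"
    "\<And>x y. x \<in> V \<Longrightarrow> y \<in> V \<Longrightarrow> \<exists>n\<le>d. (x, y) \<in> r ^^ n"
proof -
  define dist where "dist x y = (LEAST n. (x, y) \<in> r ^^ n)" for x y
  have dist: "(x, y) \<in> r ^^ dist x y" if "x \<in> V" "y \<in> V" for x y
    unfolding dist_def using assms(3)[OF that] by (rule LeastI_ex)
  define D where "D = case_prod dist ` (V \<times> V)"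
  have D: "finite D" "D \<noteq> {}" using assms(1,2) by (auto simp: D_def)
  obtain a b where ab: "a \<in> V" "b \<in> V" "dist a b = Max D"
    using Max_in[OF D] by (auto simp: D_def)
  show thesis
  proof (rule that[OF ab(1,2)])
    show "(a, b) \<in> r ^^ dist a b" using dist ab by blast
    show "dist a b \<le> n" if "(a, b) \<in> r ^^ n" for n
      unfolding dist_def using that by (rule Least_le)
    fix x y assume xy: "x \<in> V" "y \<in> V"
    then have "dist x y \<in> D" by (auto simp: D_def)
    then have "dist x y \<le> dist a b" using ab(3) Max_ge[OF D(1)] by simp
    then show "\<exists>n\<le>dist a b. (x, y) \<in> r ^^ n" using dist[OF xy] by blast
  qed
qed

theorem theorem8:
  fixes G :: "'a pair_pre_digraph"
  assumes "pair_graph G"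
    and "connected (with_proj G)"
    and "induced_free (with_proj S122) (with_proj G)"
    and "induced_free (with_proj net) (with_proj G)"
  shows "ereal (real (rvc (with_proj G))) \<le> diam (with_proj G) + 11"
proof -
  interpret pair_graph G by fact
  interpret S122_net_free_graph "pverts G" "parcs G"
    using S122_net_free_graphI assms by blast
  have "pverts G \<noteq> {}"
    using assms(2) connected_conv[of "with_proj G"] by simp
  then obtain a b d where ab: "a \<in> pverts G" "b \<in> pverts G" "(a, b) \<in> parcs G ^^ d"
    and far: "\<And>n. (a, b) \<in> parcs G ^^ n \<Longrightarrow> d \<le> n"
    and short: "\<And>x y. x \<in> pverts G \<Longrightarrow> y \<in> pverts G \<Longrightarrow> \<exists>n\<le>d. (x, y) \<in> parcs G ^^ n"
    using exists_diametral_pair[of "pverts G" "parcs G"] pair_finite_verts connected_relpow[OF assms(1,2)]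
    by metis
  have "\<exists>c. rainbow c \<and> c ` pverts G \<subseteq> {..<d + 11}"
  proof (cases "3 \<le> d")
    case True
    obtain v where v: "v 0 = a" "v d = b" "\<And>i. i < d \<Longrightarrow> (v i, v (Suc i)) \<in> parcs G"
      using ab(3) unfolding relpow_fun_conv by blast
    interpret diametral_path "pverts G" "parcs G" v d
      using v far short True by unfold_locales auto
    show ?thesis
    proof (cases "\<forall>w \<in> pverts G. level w \<le> 6")
      case True
      then show ?thesis using layered_colouring by blast
    next
      case False
      then obtain w where "w \<in> pverts G" "7 \<le> level w" by (auto simp: not_le)
      then show ?thesis using cyclic_colouring by fastforce
    qed
  next
    case False
    \<comment> \<open>For \<open>d \<le> 2\<close> any two vertices are joined by a walk with at
      most one inner vertex, so one colour is enough.\<close>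
    have "rainbow (\<lambda>_. 0)" unfolding rainbow_def
    proof (intro ballI impI)
      fix u w assume uw: "u \<in> pverts G" "w \<in> pverts G" "u \<noteq> w"
      obtain n where n: "n \<le> d" "(u, w) \<in> parcs G ^^ n" using short uw by blast
      then consider "n = 0" | "n = 1" | "n = 2" using False by linarith
      then obtain y where "linked {u, y, w} u w"
      proof cases
        case 1
        then show thesis using n(2) uw(3) by simp
      next
        case 2
        \<comment> \<open>There is no inner vertex here, so \<open>u\<close> stands in for
          \<open>y\<close>.\<close>
        then have "linked {u, u, w} u w" using n(2) by (intro linked_edge) auto
        then show thesis by (rule that)
      next
        case 3
        then obtain y where y: "(u, y) \<in> parcs G" "(y, w) \<in> parcs G"
          using n(2) by (auto simp: numeral_2_eq_2)
        have "linked {u, y, w} u w"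
          by (rule linked_edge_trans[OF y(1) linked_edge[OF y(2)]]) auto
        then show thesis by (rule that)
      qed
      moreover have "inj_on (\<lambda>_. 0 :: nat) ({u, y, w} - {u, w})" by (auto simp: inj_on_def)
      ultimately show "\<exists>A. linked A u w \<and> inj_on (\<lambda>_. 0 :: nat) (A - {u, w})" by blast
    qed
    then show ?thesis by (intro exI[of _ "\<lambda>_. 0"]) auto
  qed
  then obtain c where c: "rainbow c" "c ` pverts G \<subseteq> {..<d + 11}" by blast
  have "rvc (with_proj G) \<le> card (c ` pverts G)"
    using c(1) unfolding rainbow_def linked_def
    by (intro rvc_le_card_colours pair_wf_digraph_axioms) blast
  also have "\<dots> \<le> d + 11" using card_mono[OF _ c(2)] by simp
  finally have "ereal (real (rvc (with_proj G))) \<le> ereal (real (d + 11))" by simp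
  also have "\<dots> = ereal (real d) + 11" by simp
  also have "\<dots> \<le> diam (with_proj G) + 11"
    using diam_ge[OF pair_wf_digraph_axioms ab(1,2) far] by (intro add_right_mono) simp
  finally show ?thesis .
qed

end
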